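(* Let $\pi$ be a recursive supernatural number and let $A$ be a finite set. Then the word problem in the $\sigma$-algebra $\Omega_A^{\sigma}\mathsf{Ab}_\pi$ is decidable: there is an algorithm which, given two $\sigma$-terms over $A$, decides whether they represent the same element of $\Omega_A^{\sigma}\mathsf{Ab}_\pi$.
   Context: $\mathbb{N}$ contains $0$. A supernatural number is a function $\pi$ from the set of primes to $\mathbb{N}\cup\{\infty\}$; positive integers are regarded as supernatural numbers via their prime factorization; $\pi'$ divides $\pi$ if $\pi'(p)\le\pi(p)$ for all primes $p$. $\pi$ is recursive if $\pi(p)\in\mathbb{N}\cup\{\infty\}$ is computable from $p$. $P_\pi$ is the set of primes $p$ with $\pi(p)\in\mathbb{N}$ (i.e. $\pi(p)\neq\infty$). $\mathsf{Ab}_\pi$ is the class of all finite abelian groups whose exponent divides $\pi$. $\overline{\Omega}_A\mathsf{Ab}_\pi$ is the free pro-$\mathsf{Ab}_\pi$ group on $A$ (written additively), a profinite abelian group. The signature $\sigma=\sigma_\pi$ consists of multiplication, $x\mapsto x^{\omega-1}=\lim_k x^{k!-1}$, and $x\mapsto x^{p^{\omega-1}}=\lim_k x^{p^{k!-1}}$ for $p\in P_\pi$; on additive groups in (pro-)$\mathsf{Ab}_\pi$ these become addition, negation, and $x\mapsto p^{\omega-1}x=\lim_k p^{k!-1}x$ for $p\in P_\pi$. $\Omega_A^\sigma\mathsf{Ab}_\pi$ is the $\sigma$-subalgebra of $\overline{\Omega}_A\mathsf{Ab}_\pi$ generated by $A$. *)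

theory Defs
  imports
    "HOL-Analysis.Abstract_Limits"
    "HOL-Analysis.Function_Topology"
    "HOL-Algebra.Free_Abelian_Groups"
    "HOL-Library.Extended_Nat"
    "HOL-Library.Nat_Bijection"
    "HOL-Computational_Algebra.Primes"
begin

section \<open>Computable functions\<close>

text \<open>
  Kleene's general recursive functions: the least class of total number-theoretic functions
  that contains the basic functions and is closed under composition, primitive recursion and
  minimization of regular functions.  By Kleene's normal form theorem these are exactly the total
  computable functions.  A \<open>k\<close>-ary function is represented by a function on lists, of which
  only the values on lists of length \<open>k\<close> matter.
\<close>

inductive general_recursive :: "nat \<Rightarrow> (nat list \<Rightarrow> nat) \<Rightarrow> bool" where
  zero: "general_recursive k (\<lambda>xs. 0)"
| succ: "general_recursive 1 (\<lambda>xs. Suc (xs ! 0))"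
| proj: "i < k \<Longrightarrow> general_recursive k (\<lambda>xs. xs ! i)"
| comp: "general_recursive (length fs) g \<Longrightarrow> (\<forall>f\<in>set fs. general_recursive k f) \<Longrightarrow>
    general_recursive k (\<lambda>xs. g (map (\<lambda>f. f xs) fs))"
| prim_rec: "general_recursive k f \<Longrightarrow> general_recursive (k + 2) g \<Longrightarrow>
    general_recursive (k + 1)
      (\<lambda>xs. rec_nat (f (tl xs)) (\<lambda>n r. g (n # r # tl xs)) (hd xs))"
| mu: "general_recursive (k + 1) g \<Longrightarrow> (\<forall>xs. length xs = k \<longrightarrow> (\<exists>n. g (n # xs) = 0)) \<Longrightarrow>
    general_recursive k (\<lambda>xs. LEAST n. g (n # xs) = 0)"


section \<open>Supernatural numbers\<close>

text \<open>Only the values at primes are relevant.\<close>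

type_synonym supernatural = "nat \<Rightarrow> enat"

definition enat_code :: "enat \<Rightarrow> nat" where
  "enat_code v = (case v of enat n \<Rightarrow> Suc n | \<infinity> \<Rightarrow> 0)"

definition recursive_supernatural :: "supernatural \<Rightarrow> bool" where
  "recursive_supernatural \<pi> \<longleftrightarrow>
     (\<exists>f. general_recursive 1 f \<and> (\<forall>p. prime p \<longrightarrow> f [p] = enat_code (\<pi> p)))"

definition supernatural_dvd :: "supernatural \<Rightarrow> supernatural \<Rightarrow> bool" where
  "supernatural_dvd \<rho> \<pi> \<longleftrightarrow> (\<forall>p. prime p \<longrightarrow> \<rho> p \<le> \<pi> p)"

definition supernatural_of_nat :: "nat \<Rightarrow> supernatural" where
  "supernatural_of_nat n = (\<lambda>p. enat (multiplicity p n))"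

definition finite_primes :: "supernatural \<Rightarrow> nat set" where
  "finite_primes \<pi> = {p. prime p \<and> \<pi> p \<noteq> \<infinity>}"


section \<open>The free pro-Ab group\<close>

text \<open>Abelian groups are taken from HOL-Algebra and hence written multiplicatively.\<close>

definition group_exponent :: "('g, 'm) monoid_scheme \<Rightarrow> nat" where
  "group_exponent G = (LEAST n. 0 < n \<and> (\<forall>x\<in>carrier G. x [^]\<^bsub>G\<^esub> n = \<one>\<^bsub>G\<^esub>))"

definition in_Ab :: "supernatural \<Rightarrow> ('g, 'm) monoid_scheme \<Rightarrow> bool" where
  "in_Ab \<pi> G \<longleftrightarrow> comm_group G \<and> finite (carrier G) \<and>
     supernatural_dvd (supernatural_of_nat (group_exponent G)) \<pi>"

text \<open>
  Up to isomorphism over \<open>A\<close>, the \<open>A\<close>-generated members of the class are the quotients of the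
  free abelian group on \<open>A\<close> that belong to it.  The free profinite object is the inverse limit
  of these: the families of cosets \<open>x N\<close> that are compatible with the canonical projections.
  For \<open>N \<subseteq> M\<close> the projection from the quotient by \<open>N\<close> to the quotient by \<open>M\<close> sends a coset of
  \<open>N\<close> to the unique coset of \<open>M\<close> that contains it.
\<close>

definition Ab_kernels :: "supernatural \<Rightarrow> 'a set \<Rightarrow> ('a \<Rightarrow>\<^sub>0 int) set set" where
  "Ab_kernels \<pi> A = {N. N \<lhd> free_Abelian_group A \<and> in_Ab \<pi> (free_Abelian_group A Mod N)}"

definition free_pro_Ab ::
  "supernatural \<Rightarrow> 'a set \<Rightarrow> (('a \<Rightarrow>\<^sub>0 int) set \<Rightarrow> ('a \<Rightarrow>\<^sub>0 int) set) monoid" where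
  "free_pro_Ab \<pi> A =
     (let P = product_group (Ab_kernels \<pi> A) (\<lambda>N. free_Abelian_group A Mod N)
      in P\<lparr>carrier := {x \<in> carrier P.
             \<forall>M\<in>Ab_kernels \<pi> A. \<forall>N\<in>Ab_kernels \<pi> A. N \<subseteq> M \<longrightarrow> x N \<subseteq> x M}\<rparr>)"

definition free_pro_Ab_topology ::
  "supernatural \<Rightarrow> 'a set \<Rightarrow> (('a \<Rightarrow>\<^sub>0 int) set \<Rightarrow> ('a \<Rightarrow>\<^sub>0 int) set) topology" where
  "free_pro_Ab_topology \<pi> A =
     subtopology
       (product_topology (\<lambda>N. discrete_topology (carrier (free_Abelian_group A Mod N)))
         (Ab_kernels \<pi> A))
       (carrier (free_pro_Ab \<pi> A))"

definition free_pro_Ab_gen ::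
  "supernatural \<Rightarrow> 'a set \<Rightarrow> 'a \<Rightarrow> (('a \<Rightarrow>\<^sub>0 int) set \<Rightarrow> ('a \<Rightarrow>\<^sub>0 int) set)" where
  "free_pro_Ab_gen \<pi> A a = (\<lambda>N\<in>Ab_kernels \<pi> A. N #>\<^bsub>free_Abelian_group A\<^esub> frag_of a)"


section \<open>The implicit operations of the signature\<close>

text \<open>
  The limit of the powers of \<open>x\<close> with exponents \<open>e 0, e 1, \<dots>\<close>; limits are unique because
  the topology is Hausdorff.
\<close>

definition limit_power ::
  "supernatural \<Rightarrow> 'a set \<Rightarrow> (nat \<Rightarrow> nat) \<Rightarrow>
   (('a \<Rightarrow>\<^sub>0 int) set \<Rightarrow> ('a \<Rightarrow>\<^sub>0 int) set) \<Rightarrow> (('a \<Rightarrow>\<^sub>0 int) set \<Rightarrow> ('a \<Rightarrow>\<^sub>0 int) set)" where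
  "limit_power \<pi> A e x =
     (THE y. limitin (free_pro_Ab_topology \<pi> A)
               (\<lambda>k. x [^]\<^bsub>free_pro_Ab \<pi> A\<^esub> e k) y sequentially)"

definition omega_minus_one where
  "omega_minus_one \<pi> A = limit_power \<pi> A (\<lambda>k. fact k - 1)"

definition prime_omega_minus_one where
  "prime_omega_minus_one \<pi> A p = limit_power \<pi> A (\<lambda>k. p ^ (fact k - 1))"

inductive_set Omega_sigma ::
  "supernatural \<Rightarrow> 'a set \<Rightarrow> (('a \<Rightarrow>\<^sub>0 int) set \<Rightarrow> ('a \<Rightarrow>\<^sub>0 int) set) set"
  for \<pi> :: supernatural and A :: "'a set" where
  gen: "a \<in> A \<Longrightarrow> free_pro_Ab_gen \<pi> A a \<in> Omega_sigma \<pi> A"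
| mult: "x \<in> Omega_sigma \<pi> A \<Longrightarrow> y \<in> Omega_sigma \<pi> A \<Longrightarrow>
    x \<otimes>\<^bsub>free_pro_Ab \<pi> A\<^esub> y \<in> Omega_sigma \<pi> A"
| omega: "x \<in> Omega_sigma \<pi> A \<Longrightarrow> omega_minus_one \<pi> A x \<in> Omega_sigma \<pi> A"
| prime_omega: "p \<in> finite_primes \<pi> \<Longrightarrow> x \<in> Omega_sigma \<pi> A \<Longrightarrow>
    prime_omega_minus_one \<pi> A p x \<in> Omega_sigma \<pi> A"


section \<open>Terms and their word problem\<close>

datatype 'a sigma_term =
    Var 'a
  | Mult "'a sigma_term" "'a sigma_term"
  | Omega "'a sigma_term"
  | Prime_Omega nat "'a sigma_term"

inductive_set sigma_terms :: "supernatural \<Rightarrow> 'a set \<Rightarrow> 'a sigma_term set"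
  for \<pi> :: supernatural and A :: "'a set" where
  "a \<in> A \<Longrightarrow> Var a \<in> sigma_terms \<pi> A"
| "s \<in> sigma_terms \<pi> A \<Longrightarrow> t \<in> sigma_terms \<pi> A \<Longrightarrow> Mult s t \<in> sigma_terms \<pi> A"
| "t \<in> sigma_terms \<pi> A \<Longrightarrow> Omega t \<in> sigma_terms \<pi> A"
| "p \<in> finite_primes \<pi> \<Longrightarrow> t \<in> sigma_terms \<pi> A \<Longrightarrow> Prime_Omega p t \<in> sigma_terms \<pi> A"

primrec sigma_value ::
  "supernatural \<Rightarrow> 'a set \<Rightarrow> 'a sigma_term \<Rightarrow> (('a \<Rightarrow>\<^sub>0 int) set \<Rightarrow> ('a \<Rightarrow>\<^sub>0 int) set)" where
  "sigma_value \<pi> A (Var a) = free_pro_Ab_gen \<pi> A a"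
| "sigma_value \<pi> A (Mult s t) = sigma_value \<pi> A s \<otimes>\<^bsub>free_pro_Ab \<pi> A\<^esub> sigma_value \<pi> A t"
| "sigma_value \<pi> A (Omega t) = omega_minus_one \<pi> A (sigma_value \<pi> A t)"
| "sigma_value \<pi> A (Prime_Omega p t) = prime_omega_minus_one \<pi> A p (sigma_value \<pi> A t)"

lemma sigma_value_image: "sigma_value \<pi> A ` sigma_terms \<pi> A = Omega_sigma \<pi> A"
proof (intro equalityI subsetI)
  fix x assume "x \<in> sigma_value \<pi> A ` sigma_terms \<pi> A"
  then obtain t where t: "t \<in> sigma_terms \<pi> A" and x: "x = sigma_value \<pi> A t" by blast
  from t have "sigma_value \<pi> A t \<in> Omega_sigma \<pi> A"
    by induction (auto intro: Omega_sigma.intros)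
  with x show "x \<in> Omega_sigma \<pi> A" by simp
next
  fix x assume "x \<in> Omega_sigma \<pi> A"
  then show "x \<in> sigma_value \<pi> A ` sigma_terms \<pi> A"
  proof induction
    case (gen a)
    then show ?case
      by (intro image_eqI[of _ _ "Var a"]) (auto intro: sigma_terms.intros)
  next
    case (mult x y)
    then obtain s t where "s \<in> sigma_terms \<pi> A" "t \<in> sigma_terms \<pi> A"
      "x = sigma_value \<pi> A s" "y = sigma_value \<pi> A t" by blast
    then show ?case
      by (intro image_eqI[of _ _ "Mult s t"]) (auto intro: sigma_terms.intros)
  next
    case (omega x)
    then obtain t where "t \<in> sigma_terms \<pi> A" "x = sigma_value \<pi> A t" by blast
    then show ?case
      by (intro image_eqI[of _ _ "Omega t"]) (auto intro: sigma_terms.intros)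
  next
    case (prime_omega p x)
    then obtain t where "t \<in> sigma_terms \<pi> A" "x = sigma_value \<pi> A t" by blast
    with prime_omega show ?case
      by (intro image_eqI[of _ _ "Prime_Omega p t"]) (auto intro: sigma_terms.intros)
  qed
qed

text \<open>Goedel numbers of terms, relative to a numbering \<open>c\<close> of the letters.\<close>

primrec term_code :: "('a \<Rightarrow> nat) \<Rightarrow> 'a sigma_term \<Rightarrow> nat" where
  "term_code c (Var a) = prod_encode (0, c a)"
| "term_code c (Mult s t) = prod_encode (1, prod_encode (term_code c s, term_code c t))"
| "term_code c (Omega t) = prod_encode (2, term_code c t)"
| "term_code c (Prime_Omega p t) = prod_encode (3, prod_encode (p, term_code c t))"

text \<open>The algorithm receives two terms; its output on other inputs is irrelevant.\<close>

definition decidable_word_problem :: "supernatural \<Rightarrow> 'a set \<Rightarrow> bool" where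
  "decidable_word_problem \<pi> A \<longleftrightarrow>
     (\<forall>c. inj_on c A \<longrightarrow>
       (\<exists>f. general_recursive 2 f \<and>
         (\<forall>s\<in>sigma_terms \<pi> A. \<forall>t\<in>sigma_terms \<pi> A.
            f [term_code c s, term_code c t] =
              (if sigma_value \<pi> A s = sigma_value \<pi> A t then 1 else 0))))"

end

theory Submission
  imports
    Defs
    "HOL-Algebra.Multiplicative_Group"
    "HOL-Analysis.Abstract_Topological_Spaces"
    "HOL-Number_Theory.Residues"
begin

text \<open>
  In a quotient of the free abelian group whose exponent divides \<open>m\<close>, the operations of the
  signature become multiplications by the natural numbers \<open>m! - 1\<close> and \<open>p\<^bsup>m!-1\<^esup>\<close>.  Hence two terms have
  the same value iff, for every \<open>m\<close> dividing \<open>\<pi>\<close> and every letter, the coefficients computed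
  with these numbers agree modulo \<open>m\<close>.  A single modulus suffices: at a prime \<open>q\<close> the
  difference of the coefficients is a fraction whose numerator is bounded in terms of the codes of the
  terms, so for \<open>\<pi>(q) = \<infinity>\<close> a large power of \<open>q\<close> decides whether it vanishes, and for all primes
  not occurring in the terms the fraction is the same.  If infinitely many primes divide \<open>\<pi>\<close>, one
  of them that exceeds the bound forces this common fraction to vanish; otherwise only the
  finitely many prime divisors of \<open>\<pi>\<close> matter.
\<close>

section \<open>Closure properties of computable functions\<close>

text \<open>\<open>general_recursive\<close> speaks about one particular function on lists of every
  length. Asking only for agreement on lists of length \<open>k\<close> allows rewriting inside the
  function, so that closure properties can be stated for ordinary expressions.\<close>

definition computable :: "nat \<Rightarrow> (nat list \<Rightarrow> nat) \<Rightarrow> bool" where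
  "computable k F \<longleftrightarrow> (\<exists>G. general_recursive k G \<and> (\<forall>xs. length xs = k \<longrightarrow> G xs = F xs))"

lemma computable_cong:
  assumes "computable k F" "\<And>xs. length xs = k \<Longrightarrow> F xs = G xs"
  shows "computable k G"
  using assms by (auto simp: computable_def)

lemma general_recursive_imp_computable: "general_recursive k F \<Longrightarrow> computable k F"
  by (auto simp: computable_def)

named_theorems computable_intros

lemma computable_nth [computable_intros]: "i < k \<Longrightarrow> computable k (\<lambda>xs. xs ! i)"
  by (intro general_recursive_imp_computable general_recursive.proj)

lemma computable_compose:
  assumes "computable (length fs) g" "\<And>f. f \<in> set fs \<Longrightarrow> computable k f"
  shows "computable k (\<lambda>xs. g (map (\<lambda>f. f xs) fs))"
proof -
  obtain G where G: "general_recursive (length fs) G" "\<And>xs. length xs = length fs \<Longrightarrow> G xs = g xs"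
    using assms(1) by (auto simp: computable_def)
  obtain H where H: "\<And>f. f \<in> set fs \<Longrightarrow> general_recursive k (H f)"
      "\<And>f xs. f \<in> set fs \<Longrightarrow> length xs = k \<Longrightarrow> H f xs = f xs"
    using assms(2) unfolding computable_def by metis
  have "general_recursive k (\<lambda>xs. G (map (\<lambda>f. f xs) (map H fs)))"
    using G(1) H(1) by (intro general_recursive.comp) auto
  moreover have "G (map (\<lambda>f. f xs) (map H fs)) = g (map (\<lambda>f. f xs) fs)" if "length xs = k" for xs
  proof -
    have "map (\<lambda>f. f xs) (map H fs) = map (\<lambda>f. f xs) fs"
      using H(2) that by auto
    then show ?thesis
      by (metis G(2) length_map)
  qed
  ultimately show ?thesis
    unfolding computable_def by blast
qed

lemma computable_comp1:
  assumes "computable 1 (\<lambda>xs. h (xs ! 0))" "computable k f"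
  shows "computable k (\<lambda>xs. h (f xs))"
  using computable_compose[of "[f]" "\<lambda>xs. h (xs ! 0)" k] assms by auto

lemma computable_comp2:
  assumes "computable 2 (\<lambda>xs. h (xs ! 0) (xs ! 1))" "computable k f" "computable k g"
  shows "computable k (\<lambda>xs. h (f xs) (g xs))"
  using computable_compose[of "[f, g]" "\<lambda>xs. h (xs ! 0) (xs ! 1)" k] assms
  by (auto simp: numeral_2_eq_2)

lemma computable_Suc [computable_intros]: "computable k f \<Longrightarrow> computable k (\<lambda>xs. Suc (f xs))"
  by (rule computable_comp1[OF general_recursive_imp_computable[OF general_recursive.succ]])

lemma computable_const [computable_intros]: "computable k (\<lambda>xs. c)"
  by (induction c) (auto intro: computable_intros general_recursive_imp_computable general_recursive.zero)

lemma computable_rec_nat: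
  assumes n: "computable k n" and f: "computable k f"
    and g: "computable (Suc (Suc k)) (\<lambda>xs. g (xs ! 0) (xs ! 1) (drop 2 xs))"
  shows "computable k (\<lambda>xs. rec_nat (f xs) (\<lambda>i r. g i r xs) (n xs))"
proof -
  obtain F where F: "general_recursive k F" "\<And>xs. length xs = k \<Longrightarrow> F xs = f xs"
    using f by (auto simp: computable_def)
  obtain G where G: "general_recursive (k + 2) G"
      "\<And>xs. length xs = k + 2 \<Longrightarrow> G xs = g (xs ! 0) (xs ! 1) (drop 2 xs)"
    using g by (auto simp: computable_def)
  define R where "R = (\<lambda>xs. rec_nat (F (tl xs)) (\<lambda>n r. G (n # r # tl xs)) (hd xs))"
  have "computable (k + 1) R"
    using general_recursive.prim_rec[OF F(1) G(1)]
    by (simp add: R_def general_recursive_imp_computable)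
  \<comment> \<open>\<open>R\<close> recurses on the head of its list, so it is fed the bound
    \<open>n\<close> followed by all \<open>k\<close> projections, which hand on the whole of
    \<open>xs\<close> as parameters.\<close>
  then have "computable k (\<lambda>xs. R (map (\<lambda>h. h xs) (n # map (\<lambda>i xs. xs ! i) [0..<k])))"
    using n by (intro computable_compose) (auto intro: computable_intros)
  then show ?thesis
  proof (rule computable_cong)
    fix xs :: "nat list" assume len: "length xs = k"
    have xs: "map ((\<lambda>h. h xs) \<circ> (\<lambda>i xs. xs ! i)) [0..<k] = xs"
      using len by (intro nth_equalityI) auto
    have "rec_nat (f xs) (\<lambda>n r. G (n # r # xs)) m = rec_nat (f xs) (\<lambda>i r. g i r xs) m" for m
      using len by (induction m) (auto simp: G(2))
    then show "R (map (\<lambda>h. h xs) (n # map (\<lambda>i xs. xs ! i) [0..<k]))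
        = rec_nat (f xs) (\<lambda>i r. g i r xs) (n xs)"
      using len by (simp add: R_def xs F(2))
  qed
qed

lemma computable_Least:
  assumes "computable (Suc k) (\<lambda>xs. g (xs ! 0) (drop 1 xs))"
    and "\<And>xs. length xs = k \<Longrightarrow> \<exists>n. g n xs = 0"
  shows "computable k (\<lambda>xs. LEAST n. g n xs = 0)"
proof -
  obtain G where G: "general_recursive (k + 1) G"
      "\<And>xs. length xs = k + 1 \<Longrightarrow> G xs = g (xs ! 0) (drop 1 xs)"
    using assms(1) by (auto simp: computable_def)
  have "general_recursive k (\<lambda>xs. LEAST n. G (n # xs) = 0)"
    using assms(2) by (intro general_recursive.mu[OF G(1)]) (auto simp: G(2))
  then show ?thesis
    by (rule computable_cong[OF general_recursive_imp_computable]) (auto simp: G(2))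
qed

lemma computable_nth_drop [computable_intros]: "j + i < k \<Longrightarrow> computable k (\<lambda>xs. drop j xs ! i)"
  by (rule computable_cong[of _ "\<lambda>xs. xs ! (j + i)"]) (auto intro: computable_intros)

lemma computable_add [computable_intros]:
  assumes "computable k f" "computable k g"
  shows "computable k (\<lambda>xs. f xs + g xs)"
proof -
  have "computable k (\<lambda>xs. rec_nat (f xs) (\<lambda>i r. Suc r) (g xs))"
    using assms by (intro computable_rec_nat computable_intros; simp)
  moreover have "rec_nat a (\<lambda>i. Suc) b = a + b" for a b
    by (induction b) auto
  ultimately show ?thesis
    by simp
qed

lemma computable_mult [computable_intros]:
  assumes "computable k f" "computable k g"
  shows "computable k (\<lambda>xs. f xs * g xs)"
proof -
  have "computable 2 (\<lambda>xs. rec_nat 0 (\<lambda>i r. xs ! 0 + r) (xs ! 1))"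
    by (intro computable_rec_nat computable_intros; simp)
  moreover have "rec_nat 0 (\<lambda>i r. a + r) b = a * b" for a b :: nat
    by (induction b) auto
  ultimately have "computable 2 (\<lambda>xs. xs ! 0 * xs ! 1)"
    by simp
  then show ?thesis
    by (rule computable_comp2[of "(*)", OF _ assms])
qed

lemma computable_power [computable_intros]:
  assumes "computable k f" "computable k g"
  shows "computable k (\<lambda>xs. f xs ^ g xs)"
proof -
  have "computable 2 (\<lambda>xs. rec_nat 1 (\<lambda>i r. xs ! 0 * r) (xs ! 1))"
    by (intro computable_rec_nat computable_intros; simp)
  moreover have "rec_nat 1 (\<lambda>i r. a * r) b = a ^ b" for a b :: nat
    by (induction b) auto
  ultimately have "computable 2 (\<lambda>xs. xs ! 0 ^ xs ! 1)"
    by simp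
  then show ?thesis
    by (rule computable_comp2[of "(^)", OF _ assms])
qed

lemma computable_fact [computable_intros]:
  assumes "computable k f"
  shows "computable k (\<lambda>xs. fact (f xs))"
proof -
  have "computable 1 (\<lambda>xs. rec_nat 1 (\<lambda>i r. Suc i * r) (xs ! 0))"
    by (intro computable_rec_nat computable_intros; simp)
  moreover have "rec_nat 1 (\<lambda>i r. Suc i * r) a = fact a" for a
    by (induction a) auto
  ultimately have "computable 1 (\<lambda>xs. fact (xs ! 0))"
    by simp
  then show ?thesis
    by (rule computable_comp1[of fact, OF _ assms])
qed

lemma computable_diff [computable_intros]:
  assumes "computable k f" "computable k g"
  shows "computable k (\<lambda>xs. f xs - g xs)"
proof -
  have "computable 1 (\<lambda>xs. rec_nat 0 (\<lambda>i r. i) (xs ! 0))"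
    by (intro computable_rec_nat computable_intros; simp)
  moreover have "rec_nat 0 (\<lambda>i r. i) a = a - 1" for a
    by (cases a) auto
  ultimately have pred: "computable 1 (\<lambda>xs. xs ! 0 - 1)"
    by simp
  have "computable 2 (\<lambda>xs. rec_nat (xs ! 0) (\<lambda>i r. r - 1) (xs ! 1))"
    by (intro computable_rec_nat computable_comp1[OF pred] computable_intros; simp)
  moreover have "rec_nat a (\<lambda>i r. r - 1) b = a - b" for a b :: nat
    by (induction b) auto
  ultimately have "computable 2 (\<lambda>xs. xs ! 0 - xs ! 1)"
    by simp
  then show ?thesis
    by (rule computable_comp2[of "(-)", OF _ assms])
qed

lemma computable_min [computable_intros]:
  assumes "computable k f" "computable k g"
  shows "computable k (\<lambda>xs. min (f xs) (g xs))"
proof -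
  have "min (f xs) (g xs) = f xs - (f xs - g xs)" for xs
    by simp
  then show ?thesis
    using assms by (simp add: computable_intros)
qed

section \<open>Decidable predicates and total searches\<close>

definition decidable :: "nat \<Rightarrow> (nat list \<Rightarrow> bool) \<Rightarrow> bool" where
  "decidable k P \<longleftrightarrow> computable k (\<lambda>xs. of_bool (P xs))"

lemma decidable_le [computable_intros]:
  assumes "computable k f" "computable k g"
  shows "decidable k (\<lambda>xs. f xs \<le> g xs)"
  unfolding decidable_def
  by (rule computable_cong[of _ "\<lambda>xs. 1 - (f xs - g xs)"]) (auto intro!: computable_intros assms)

lemma decidable_not [computable_intros]: "decidable k P \<Longrightarrow> decidable k (\<lambda>xs. \<not> P xs)"
  unfolding decidable_def
  by (rule computable_cong[of _ "\<lambda>xs. 1 - of_bool (P xs)"]) (auto intro!: computable_intros)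

lemma decidable_conj [computable_intros]:
  "decidable k P \<Longrightarrow> decidable k Q \<Longrightarrow> decidable k (\<lambda>xs. P xs \<and> Q xs)"
  unfolding decidable_def
  by (rule computable_cong[of _ "\<lambda>xs. of_bool (P xs) * of_bool (Q xs)"]) (auto intro!: computable_intros)

lemma decidable_disj [computable_intros]:
  assumes "decidable k P" "decidable k Q"
  shows "decidable k (\<lambda>xs. P xs \<or> Q xs)"
proof -
  have "decidable k (\<lambda>xs. \<not> (\<not> P xs \<and> \<not> Q xs))"
    by (intro computable_intros assms)
  then show ?thesis
    by simp
qed

lemma decidable_less [computable_intros]:
  "computable k f \<Longrightarrow> computable k g \<Longrightarrow> decidable k (\<lambda>xs. f xs < g xs)"
  using decidable_le[of k "\<lambda>xs. Suc (f xs)" g] by (simp add: Suc_le_eq computable_intros)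

lemma decidable_eq [computable_intros]:
  "computable k f \<Longrightarrow> computable k g \<Longrightarrow> decidable k (\<lambda>xs. f xs = g xs)"
  unfolding order_eq_iff by (intro computable_intros)

lemma decidable_ball [computable_intros]:
  assumes "finite S" "\<And>i. i \<in> S \<Longrightarrow> decidable k (P i)"
  shows "decidable k (\<lambda>xs. \<forall>i\<in>S. P i xs)"
  using assms by induction (auto simp: decidable_def[of _ "\<lambda>xs. True"] intro!: computable_intros)

lemma computable_if [computable_intros]:
  assumes "decidable k P" "computable k f" "computable k g"
  shows "computable k (\<lambda>xs. if P xs then f xs else g xs)"
proof (rule computable_cong)
  show "computable k (\<lambda>xs. of_bool (P xs) * f xs + (1 - of_bool (P xs)) * g xs)"
    using assms unfolding decidable_def by (intro computable_intros)
qed auto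

lemma computable_Least_decidable:
  assumes "decidable (Suc k) (\<lambda>xs. P (xs ! 0) (drop 1 xs))"
    and "\<And>xs. length xs = k \<Longrightarrow> \<exists>n. P n xs"
  shows "computable k (\<lambda>xs. LEAST n. P n xs)"
proof -
  have "computable k (\<lambda>xs. LEAST n. of_bool (\<not> P n xs) = (0::nat))"
    using decidable_not[OF assms(1)] assms(2) unfolding decidable_def
    by (intro computable_Least) simp_all
  then show ?thesis
    by simp
qed

lemma computable_mod [computable_intros]:
  assumes "computable k f" "computable k g"
  shows "computable k (\<lambda>xs. f xs mod g xs)"
proof -
  \<comment> \<open>The quotient is found by minimization. The disjunct for a zero divisor keeps the
    search total, and its outcome 0 then agrees with \<open>a mod 0 = a\<close>.\<close>
  have "computable 2 (\<lambda>xs. LEAST q. xs ! 1 = 0 \<or> xs ! 0 < Suc q * xs ! 1)"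
  proof (rule computable_Least_decidable)
    fix xs :: "nat list"
    have "xs ! 0 < Suc (xs ! 0) * xs ! 1" if "xs ! 1 \<noteq> 0"
      using that by (cases "xs ! 1") auto
    then show "\<exists>q. xs ! 1 = 0 \<or> xs ! 0 < Suc q * xs ! 1"
      by (intro exI[of _ "xs ! 0"]) linarith
  qed (intro computable_intros; simp)
  then have "computable 2 (\<lambda>xs. xs ! 0 - (LEAST q. xs ! 1 = 0 \<or> xs ! 0 < Suc q * xs ! 1) * xs ! 1)"
    by (intro computable_intros) simp_all
  moreover have "a - (LEAST q. b = 0 \<or> a < Suc q * b) * b = a mod b" for a b :: nat
  proof (cases "b = 0")
    case False
    have "(LEAST q. b = 0 \<or> a < Suc q * b) = a div b"
    proof (rule Least_equality)
      show "b = 0 \<or> a < Suc (a div b) * b"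
        using False by (metis dividend_less_div_times mult_Suc not_gr_zero)
      show "a div b \<le> q" if "b = 0 \<or> a < Suc q * b" for q
        using that False by (metis less_Suc_eq_le less_mult_imp_div_less)
    qed
    then show ?thesis
      by (simp add: minus_div_mult_eq_mod)
  qed auto
  ultimately have "computable 2 (\<lambda>xs. xs ! 0 mod xs ! 1)"
    by simp
  then show ?thesis
    by (rule computable_comp2[of "(mod)", OF _ assms])
qed

text \<open>This turns primality into one minimization that always succeeds: the disjunct
  \<open>n \<le> d\<close> makes \<open>n\<close> itself a witness, even for 0 and 1.\<close>

lemma prime_iff_least_divisor:
  "prime (n::nat) \<longleftrightarrow> 2 \<le> n \<and> (LEAST d. 2 \<le> d \<and> n mod d = 0 \<or> n \<le> d) = n"
proof
  assume n: "prime n"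
  have "(LEAST d. 2 \<le> d \<and> n mod d = 0 \<or> n \<le> d) = n"
  proof (rule Least_equality)
    fix d assume "2 \<le> d \<and> n mod d = 0 \<or> n \<le> d"
    then show "n \<le> d"
      using n by (auto simp: prime_nat_iff)
  qed simp
  then show "2 \<le> n \<and> (LEAST d. 2 \<le> d \<and> n mod d = 0 \<or> n \<le> d) = n"
    using n by (simp add: prime_ge_2_nat)
next
  assume n: "2 \<le> n \<and> (LEAST d. 2 \<le> d \<and> n mod d = 0 \<or> n \<le> d) = n"
  show "prime n"
    unfolding prime_nat_iff
  proof (intro conjI allI impI)
    fix d assume "d dvd n"
    then have "n \<le> d" if "2 \<le> d"
      using Least_le[of "\<lambda>d. 2 \<le> d \<and> n mod d = 0 \<or> n \<le> d" d] n that by auto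
    moreover have "d \<noteq> 0" "d \<le> n"
      using \<open>d dvd n\<close> n by (auto intro: dvd_imp_le intro!: Nat.gr0I)
    ultimately show "d = 1 \<or> d = n"
      by linarith
  qed (use n in simp)
qed

lemma decidable_prime [computable_intros]:
  assumes "computable k f"
  shows "decidable k (\<lambda>xs. prime (f xs))"
proof -
  have "computable 1 (\<lambda>xs. LEAST d. 2 \<le> d \<and> xs ! 0 mod d = 0 \<or> xs ! 0 \<le> d)"
    by (rule computable_Least_decidable)
      ((intro computable_intros; simp), auto)
  then have "computable 1 (\<lambda>xs. of_bool (prime (xs ! 0)))"
    unfolding prime_iff_least_divisor decidable_def[symmetric]
    by (intro computable_intros) simp_all
  then show ?thesis
    unfolding decidable_def by (rule computable_comp1[of "\<lambda>n. of_bool (prime n)", OF _ assms])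
qed

section \<open>Cantor pairing and its inverse\<close>

lemma computable_triangle [computable_intros]:
  assumes "computable k f"
  shows "computable k (\<lambda>xs. triangle (f xs))"
proof -
  have "computable 1 (\<lambda>xs. rec_nat 0 (\<lambda>i r. r + Suc i) (xs ! 0))"
    by (intro computable_rec_nat computable_intros; simp)
  moreover have "rec_nat 0 (\<lambda>i r. r + Suc i) a = triangle a" for a
    by (induction a) auto
  ultimately have "computable 1 (\<lambda>xs. triangle (xs ! 0))"
    by simp
  then show ?thesis
    by (rule computable_comp1[of triangle, OF _ assms])
qed

lemma computable_prod_encode [computable_intros]:
  "computable k f \<Longrightarrow> computable k g \<Longrightarrow> computable k (\<lambda>xs. prod_encode (f xs, g xs))"
  unfolding prod_encode_def by (auto intro!: computable_intros)

text \<open>The index of the antidiagonal on which the pairing puts the pair with code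
  \<open>n\<close>; both components can be read off from it.\<close>

definition diagonal :: "nat \<Rightarrow> nat" where
  "diagonal n = (LEAST w. n < triangle (Suc w))"

text \<open>The code is \<open>triangle (a + b) + a\<close> with \<open>a \<le> a + b\<close>, so it
  lies between two consecutive triangular numbers.\<close>

lemma diagonal_prod_encode: "diagonal (prod_encode (a, b)) = a + b"
  unfolding diagonal_def prod_encode_def
proof (rule Least_equality, goal_cases)
  case (2 w)
  have "mono triangle"
    by (simp add: mono_iff_le_Suc)
  then show ?case
    using 2 by (metis add_lessD1 case_prod_conv leD leI monoD not_less_eq_eq)
qed auto

lemma fst_prod_decode: "fst (prod_decode n) = n - triangle (diagonal n)"
  and snd_prod_decode: "snd (prod_decode n) = diagonal n - fst (prod_decode n)"
proof -
  obtain a b where "prod_decode n = (a, b)"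
    by fastforce
  then have n: "n = prod_encode (a, b)"
    by (metis prod_decode_inverse)
  show "fst (prod_decode n) = n - triangle (diagonal n)"
    unfolding n diagonal_prod_encode prod_encode_inverse by (simp add: prod_encode_def)
  show "snd (prod_decode n) = diagonal n - fst (prod_decode n)"
    unfolding n diagonal_prod_encode prod_encode_inverse by simp
qed

lemma computable_diagonal [computable_intros]:
  assumes "computable k f"
  shows "computable k (\<lambda>xs. diagonal (f xs))"
proof -
  have "computable 1 (\<lambda>xs. diagonal (xs ! 0))"
    unfolding diagonal_def
  proof (rule computable_Least_decidable)
    fix xs :: "nat list"
    have "n < triangle (Suc n)" for n
      by (induction n) auto
    then show "\<exists>n. xs ! 0 < triangle (Suc n)"
      by blast
  qed (intro computable_intros; simp)
  then show ?thesis
    by (rule computable_comp1[of diagonal, OF _ assms])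
qed

lemma computable_fst_prod_decode [computable_intros]:
  "computable k f \<Longrightarrow> computable k (\<lambda>xs. fst (prod_decode (f xs)))"
  unfolding fst_prod_decode by (auto intro!: computable_intros)

lemma computable_snd_prod_decode [computable_intros]:
  "computable k f \<Longrightarrow> computable k (\<lambda>xs. snd (prod_decode (f xs)))"
  unfolding snd_prod_decode by (auto intro!: computable_intros)

section \<open>Coefficients of terms modulo a natural number\<close>

text \<open>\<open>K\<close> is the stage at which the limits defining the implicit operations are
  cut off. Only residues modulo some \<open>m \<le> K\<close> are meaningful.\<close>

primrec coefficient :: "nat \<Rightarrow> 'a \<Rightarrow> 'a sigma_term \<Rightarrow> nat" where
  "coefficient K a (Var b) = of_bool (a = b)"
| "coefficient K a (Mult s t) = coefficient K a s + coefficient K a t"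
| "coefficient K a (Omega t) = (fact K - 1) * coefficient K a t"
| "coefficient K a (Prime_Omega p t) = p ^ (fact K - 1) * coefficient K a t"

lemma fact_cong_0: "0 < m \<Longrightarrow> m \<le> K \<Longrightarrow> [fact K = 0] (mod m :: nat)"
  by (simp add: cong_0_iff dvd_fact)

lemma cong_fact_minus_one:
  assumes "0 < m" "m \<le> K"
  shows "[int (fact K - 1) = - 1] (mod int m)"
proof -
  have "int (fact K - 1) = int (fact K) - 1"
    by (subst of_nat_diff) auto
  moreover have "[int (fact K) - 1 = 0 - 1] (mod int m)"
    using fact_cong_0[OF assms] by (intro cong_diff) (auto simp: cong_int_iff[symmetric])
  ultimately show ?thesis
    by simp
qed

text \<open>
  By the pigeonhole principle the powers of \<open>p\<close> modulo \<open>m\<close> are periodic from some exponent below \<open>m\<close>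
  on, with a period at most \<open>m\<close>.
\<close>

lemma cong_power_fact_minus_one:
  assumes "0 < m" "m \<le> K"
  shows "[p ^ (fact K - 1) = p ^ (fact m - 1)] (mod m)"
proof -
  have "\<not> inj_on (\<lambda>i. p ^ i mod m) {..m}"
  proof (rule pigeonhole)
    have "(\<lambda>i. p ^ i mod m) ` {..m} \<subseteq> {..<m}"
      using assms by auto
    then show "card ((\<lambda>i. p ^ i mod m) ` {..m}) < card {..m}"
      by (metis card_atMost card_lessThan card_mono finite_lessThan le_imp_less_Suc)
  qed
  then obtain i j where ij: "i < j" "j \<le> m" "p ^ i mod m = p ^ j mod m"
    unfolding inj_on_def by (metis atMost_iff linorder_neqE_nat)
  have step: "[p ^ (i + r + k * (j - i)) = p ^ (i + r)] (mod m)" for r k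
  proof (induction k)
    case (Suc k)
    have "[p ^ (i + r + Suc k * (j - i)) = p ^ j * p ^ (r + k * (j - i))] (mod m)"
      using ij(1) by (simp add: add.left_commute flip: power_add)
    also have "[p ^ j * p ^ (r + k * (j - i)) = p ^ i * p ^ (r + k * (j - i))] (mod m)"
      using ij(3) by (intro cong_mult) (auto simp: cong_def)
    also have "p ^ i * p ^ (r + k * (j - i)) = p ^ (i + r + k * (j - i))"
      by (simp add: power_add)
    finally show ?case
      using Suc.IH cong_trans by blast
  qed simp
  have "m \<le> fact m"
    by (rule fact_ge_self)
  \<comment> \<open>The period \<open>j - i\<close> is at most \<open>m\<close>, so it divides both
    factorials and hence the difference of the two exponents.\<close>
  have "j - i dvd fact m" "fact m dvd (fact K :: nat)"
    using ij assms by (auto intro!: dvd_fact fact_dvd)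
  moreover have le: "fact m \<le> (fact K :: nat)"
    using assms by (intro fact_mono) auto
  ultimately have "j - i dvd fact K - fact m"
    by (meson dvd_diff_nat dvd_trans)
  then obtain k where k: "fact K - fact m = (j - i) * k"
    by (elim dvdE)
  \<comment> \<open>The part of the exponent beyond the preperiod \<open>i\<close>. The subtraction
    is not truncated, since \<open>i < j \<le> m \<le> fact m\<close>.\<close>
  define r where "r = fact m - 1 - i"
  have "fact m - 1 = i + r"
    using ij \<open>m \<le> fact m\<close> by (simp add: r_def)
  moreover have "fact K - 1 = i + r + k * (j - i)"
  proof -
    have "fact K - 1 = (fact m - 1) + (fact K - fact m :: nat)"
      using le fact_ge_1[of m, where 'a = nat] by linarith
    then show ?thesis
      by (simp only: k calculation mult.commute)
  qed
  ultimately show ?thesis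
    using step[of r k] by presburger
qed

text \<open>Modulo \<open>m\<close> the operations have stabilized at stage \<open>m\<close>: the
  factor of \<open>Omega\<close> is -1 from then on, and the power of \<open>p\<close> no longer
  changes. Stages can therefore be exchanged freely once they reach the modulus.\<close>

lemma cong_coefficient:
  assumes "0 < m" "m \<le> K"
  shows "[coefficient K a t = coefficient m a t] (mod m)"
proof (induction t)
  case (Omega t)
  have "[int (fact K - 1) = int (fact m - 1)] (mod int m)"
    using cong_fact_minus_one[OF assms] cong_fact_minus_one[of m m] assms cong_sym cong_trans
    by blast
  then have "[fact K - 1 = fact m - 1] (mod m)"
    by (simp only: cong_int_iff)
  then show ?case
    unfolding coefficient.simps using Omega by (rule cong_mult)
next
  case (Prime_Omega p t)
  with cong_power_fact_minus_one[OF assms] show ?case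
    unfolding coefficient.simps by (rule cong_mult)
qed (auto intro: cong_add)

text \<open>
  The component at \<open>q\<close> of the coefficient of a letter is the fraction with numerator \<open>numer\<close> and
  denominator \<open>denom\<close>: there \<open>p\<^bsup>\<omega>-1\<^esup>\<close> stands for \<open>1/p\<close>, except that it annihilates the component
  at \<open>p\<close>.
\<close>

primrec denom :: "nat \<Rightarrow> 'a sigma_term \<Rightarrow> int" where
  "denom q (Var b) = 1"
| "denom q (Mult s t) = denom q s * denom q t"
| "denom q (Omega t) = denom q t"
| "denom q (Prime_Omega p t) = (if p = q then 1 else int p * denom q t)"

primrec numer :: "nat \<Rightarrow> 'a \<Rightarrow> 'a sigma_term \<Rightarrow> int" where
  "numer q a (Var b) = of_bool (a = b)"
| "numer q a (Mult s t) = numer q a s * denom q t + numer q a t * denom q s"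
| "numer q a (Omega t) = - numer q a t"
| "numer q a (Prime_Omega p t) = (if p = q then 0 else numer q a t)"

text \<open>The recursion for \<open>denom\<close> stops with 1 at \<open>Prime_Omega q\<close>, so
  only primes other than \<open>q\<close> enter the product.\<close>

lemma coprime_denom:
  assumes "t \<in> sigma_terms \<pi> A" "prime q"
  shows "coprime (denom q t) (int q)"
  using assms(1)
proof induction
  case (4 p t)
  then show ?case
    using assms(2) by (auto simp: finite_primes_def primes_coprime)
qed auto

text \<open>This says that the coefficient equals the fraction \<open>numer / denom\<close> modulo
  \<open>q ^ e\<close>, with the denominator cleared to avoid modular inverses.\<close>

lemma cong_coefficient_mult_denom:
  assumes "t \<in> sigma_terms \<pi> A" "prime q"
  shows "[int (coefficient (q ^ e) a t) * denom q t = numer q a t] (mod int (q ^ e))"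
  using assms(1)
proof induction
  case (2 s t)
  have "[(int (coefficient (q ^ e) a s) * denom q s) * denom q t
      + (int (coefficient (q ^ e) a t) * denom q t) * denom q s
      = numer q a s * denom q t + numer q a t * denom q s] (mod int (q ^ e))"
    by (intro cong_add cong_mult 2 cong_refl)
  then show ?case
    by (simp add: algebra_simps)
next
  case (3 t)
  have "[int (fact (q ^ e) - 1) * (int (coefficient (q ^ e) a t) * denom q t) = - 1 * numer q a t]
      (mod int (q ^ e))"
    using assms(2) by (intro cong_mult 3 cong_fact_minus_one) (auto simp: prime_gt_0_nat)
  then show ?case
    by (simp add: algebra_simps)
next
  case (4 p t)
  have p: "prime p"
    using 4 by (simp add: finite_primes_def)
  define m where "m = q ^ e"
  have "0 < m"
    using assms(2) by (simp add: m_def prime_gt_0_nat)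
  show ?case
  proof (cases "p = q")
    case True
    \<comment> \<open>The numerator is 0 in this case. Since \<open>e < m \<le> fact m\<close>, the
      exponent \<open>fact m - 1\<close> is at least \<open>e\<close>, and the power of
      \<open>q\<close> vanishes modulo \<open>m\<close>.\<close>
    have "e < m"
      unfolding m_def using assms(2) prime_gt_1_nat by (intro power_gt_expt) simp
    also have "m \<le> fact m"
      by (rule fact_ge_self)
    finally have "m dvd q ^ (fact m - 1)"
      unfolding m_def by (intro le_imp_power_dvd) simp
    then show ?thesis
      using True int_dvd_int_iff by (fastforce simp: cong_0_iff m_def simp del: of_nat_power)
  next
    case False
    have "coprime p m"
      using False p assms(2) by (simp add: m_def primes_coprime)
    \<comment> \<open>As \<open>totient m \<le> m\<close> divides \<open>fact m\<close>, Euler's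
      theorem makes \<open>p ^ (fact m - 1)\<close> an inverse of \<open>p\<close> modulo
      \<open>m\<close>; this cancels the factor \<open>p\<close> in the denominator.\<close>
    then have "[p ^ totient m = 1] (mod m)"
      by (rule euler_theorem)
    moreover have "totient m dvd fact m"
      using \<open>0 < m\<close> by (intro dvd_fact) (auto simp: totient_le Suc_le_eq)
    ultimately have "[p ^ fact m = 1] (mod m)"
      using cong_pow[of "p ^ totient m" 1 m] by (elim dvdE) (simp add: power_mult)
    then have "[p * p ^ (fact m - 1) = 1] (mod m)"
      by (simp flip: power_Suc)
    then have "[int (p * p ^ (fact m - 1)) * (int (coefficient m a t) * denom q t) = int 1 * numer q a t]
        (mod int m)"
      unfolding m_def by (intro cong_mult 4) (simp only: cong_int_iff)
    then show ?thesis
      using False by (simp add: m_def algebra_simps)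
  qed
qed auto

text \<open>Both denominators are units modulo \<open>q ^ e\<close>, so the congruence may be
  multiplied by their product. The integer on the right does not depend on \<open>e\<close>, which
  makes one large exponent decisive for all others.\<close>

lemma prime_power_dvd_coefficient_diff_iff:
  assumes "s \<in> sigma_terms \<pi> A" "t \<in> sigma_terms \<pi> A" "prime q"
  shows "[coefficient (q ^ e) a s = coefficient (q ^ e) a t] (mod q ^ e) \<longleftrightarrow>
    int (q ^ e) dvd numer q a s * denom q t - numer q a t * denom q s"
proof -
  define m where "m = int (q ^ e)"
  have "coprime (denom q s * denom q t) m"
    using coprime_denom[OF assms(1,3)] coprime_denom[OF assms(2,3)] by (simp add: m_def)
  then have "[coefficient (q ^ e) a s = coefficient (q ^ e) a t] (mod q ^ e) \<longleftrightarrow>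
      [int (coefficient (q ^ e) a s) * (denom q s * denom q t)
        = int (coefficient (q ^ e) a t) * (denom q s * denom q t)] (mod m)"
    unfolding m_def by (subst cong_mult_rcancel) (auto simp: cong_int_iff simp del: of_nat_power)
  also have "\<dots> \<longleftrightarrow> [numer q a s * denom q t = numer q a t * denom q s] (mod m)"
  proof -
    have "[(int (coefficient (q ^ e) a s) * denom q s) * denom q t = numer q a s * denom q t] (mod m)"
      "[(int (coefficient (q ^ e) a t) * denom q t) * denom q s = numer q a t * denom q s] (mod m)"
      unfolding m_def using assms by (auto intro!: cong_mult cong_coefficient_mult_denom simp del: of_nat_power)
    then show ?thesis
      by (auto simp: cong_def ac_simps)
  qed
  finally show ?thesis
    by (simp add: cong_iff_dvd_diff m_def)
qed

section \<open>Size bounds in terms of Goedel numbers\<close>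

lemma prod_encode_ge: "2 * a + b \<le> prod_encode (a, b)"
proof -
  have "n \<le> triangle n" for n
    by (induction n) auto
  from this[of "a + b"] show ?thesis
    by (simp add: prod_encode_def)
qed

text \<open>The tag of \<open>Mult\<close> supplies the surplus; one unit of it pays for the factor
  2 that adding two products costs in \<open>numer_bound\<close>.\<close>

lemma term_code_Mult: "term_code c s + term_code c t + 2 \<le> term_code c (Mult s t)"
  using prod_encode_ge[of 1 "prod_encode (term_code c s, term_code c t)"]
    prod_encode_ge[of "term_code c s" "term_code c t"] by simp

lemma term_code_Omega: "term_code c t < term_code c (Omega t)"
  using prod_encode_ge[of 2 "term_code c t"] by simp

lemma term_code_Prime_Omega: "p + term_code c t < term_code c (Prime_Omega p t)"
  using prod_encode_ge[of 3 "prod_encode (p, term_code c t)"]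
    prod_encode_ge[of p "term_code c t"] by simp

text \<open>The lower bound keeps the factors positive, as monotonicity of products requires. A new
  factor \<open>p\<close> is paid for by \<open>p < 2 ^ p\<close>, because the code grows by more
  than \<open>p\<close>.\<close>

lemma denom_bounds:
  assumes "t \<in> sigma_terms \<pi> A"
  shows "1 \<le> denom q t \<and> denom q t \<le> 2 ^ term_code c t"
  using assms
proof induction
  case (2 s t)
  have "denom q s * denom q t \<le> 2 ^ term_code c s * 2 ^ term_code c t"
    using 2 by (intro mult_mono) auto
  also have "\<dots> \<le> 2 ^ term_code c (Mult s t)"
    unfolding power_add[symmetric] using term_code_Mult[of c s t]
    by (intro power_increasing) linarith+
  finally show ?case
    using 2 mult_mono[of 1 "denom q s" 1 "denom q t"] by simp
next
  case (3 t)
  have "(2 :: int) ^ term_code c t \<le> 2 ^ term_code c (Omega t)"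
    using term_code_Omega[of c t] by (intro power_increasing) linarith+
  with 3 show ?case
    unfolding denom.simps by linarith
next
  case (4 p t)
  have "0 < p"
    using 4 by (simp add: finite_primes_def prime_gt_0_nat)
  have "int p * denom q t \<le> 2 ^ p * 2 ^ term_code c t"
    using 4 of_nat_less_two_power[of p, where 'a = int] by (intro mult_mono) auto
  also have "\<dots> \<le> 2 ^ term_code c (Prime_Omega p t)"
    unfolding power_add[symmetric] using term_code_Prime_Omega[of p c t]
    by (intro power_increasing) linarith+
  finally show ?case
    using 4 \<open>0 < p\<close> mult_mono[of 1 "int p" 1 "denom q t"] by (simp del: term_code.simps)
qed simp

lemma numer_bound:
  assumes "t \<in> sigma_terms \<pi> A"
  shows "\<bar>numer q a t\<bar> \<le> 2 ^ term_code c t"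
  using assms
proof induction
  case (2 s t)
  have d: "\<bar>denom q s\<bar> \<le> 2 ^ term_code c s" "\<bar>denom q t\<bar> \<le> 2 ^ term_code c t"
    using denom_bounds[OF 2(1), of q c] denom_bounds[OF 2(2), of q c] by auto
  have "\<bar>numer q a s * denom q t + numer q a t * denom q s\<bar>
      \<le> \<bar>numer q a s\<bar> * \<bar>denom q t\<bar> + \<bar>numer q a t\<bar> * \<bar>denom q s\<bar>"
    by (metis abs_mult abs_triangle_ineq)
  also have "\<dots> \<le> 2 ^ term_code c s * 2 ^ term_code c t + 2 ^ term_code c t * 2 ^ term_code c s"
    using 2 d by (intro add_mono mult_mono) auto
  also have "\<dots> = 2 ^ (term_code c s + term_code c t + 1)"
    by (simp add: power_add)
  also have "\<dots> \<le> 2 ^ term_code c (Mult s t)"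
    using term_code_Mult[of c s t] by (intro power_increasing) linarith+
  finally show ?case
    by simp
next
  case (3 t)
  have "(2 :: int) ^ term_code c t \<le> 2 ^ term_code c (Omega t)"
    using term_code_Omega[of c t] by (intro power_increasing) linarith+
  with 3 show ?case
    unfolding numer.simps by linarith
next
  case (4 p t)
  have "(2 :: int) ^ term_code c t \<le> 2 ^ term_code c (Prime_Omega p t)"
    using term_code_Prime_Omega[of p c t] by (intro power_increasing) linarith+
  with 4 show ?case
    by (simp del: term_code.simps power_increasing_iff)
qed simp

text \<open>The bound depends neither on the prime nor on the letter and is computable from the two
  codes; it is the threshold of the decision procedure.\<close>

lemma cross_difference_bound:
  assumes "s \<in> sigma_terms \<pi> A" "t \<in> sigma_terms \<pi> A"
  shows "\<bar>numer q a s * denom q t - numer q a t * denom q s\<bar>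
    \<le> 2 ^ Suc (term_code c s + term_code c t)"
proof -
  have d: "\<bar>denom q s\<bar> \<le> 2 ^ term_code c s" "\<bar>denom q t\<bar> \<le> 2 ^ term_code c t"
    using denom_bounds[OF assms(1), of q c] denom_bounds[OF assms(2), of q c] by auto
  have "\<bar>numer q a s * denom q t - numer q a t * denom q s\<bar>
      \<le> \<bar>numer q a s\<bar> * \<bar>denom q t\<bar> + \<bar>numer q a t\<bar> * \<bar>denom q s\<bar>"
    by (metis abs_mult abs_triangle_ineq4)
  also have "\<dots> \<le> 2 ^ term_code c s * 2 ^ term_code c t + 2 ^ term_code c t * 2 ^ term_code c s"
    using d numer_bound[OF assms(1)] numer_bound[OF assms(2)] by (intro add_mono mult_mono) auto
  also have "\<dots> = 2 ^ Suc (term_code c s + term_code c t)"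
    by (simp add: power_add)
  finally show ?thesis .
qed

text \<open>Every \<open>p\<close> in a subterm \<open>Prime_Omega p _\<close> is smaller than the
  code of the term, so the test \<open>p = q\<close> fails throughout, and what remains of the
  recursions does not mention \<open>q\<close>.\<close>

lemma fraction_at_large_prime:
  assumes "term_code c t < q" "term_code c t < r"
  shows "denom q t = denom r t" "numer q a t = numer r a t"
proof -
  have "denom q t = denom r t \<and> numer q a t = numer r a t"
    using assms
  proof (induction t)
    case (Mult s t)
    then show ?case
      using term_code_Mult[of c s t] by (simp del: term_code.simps)
  next
    case (Omega t)
    then show ?case
      using term_code_Omega[of c t] by (simp del: term_code.simps)
  next
    case (Prime_Omega p t)
    then show ?case
      using term_code_Prime_Omega[of p c t] by (simp del: term_code.simps)
  qed simp
  then show "denom q t = denom r t" "numer q a t = numer r a t"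
    by auto
qed

section \<open>The test modulus\<close>

definition truncated_exponent :: "enat \<Rightarrow> nat \<Rightarrow> nat" where
  "truncated_exponent v n = the_enat (min v (enat n))"

lemma enat_truncated_exponent: "enat (truncated_exponent v n) = min v (enat n)"
  by (cases v) (simp_all add: truncated_exponent_def)

text \<open>The product runs over all \<open>q < b\<close>, with factor 1 at nonprimes, so that it
  is a primitive recursion in \<open>b\<close>.\<close>

definition test_modulus :: "supernatural \<Rightarrow> nat \<Rightarrow> nat \<Rightarrow> nat" where
  "test_modulus \<pi> b n = (\<Prod>q<b. if prime q then q ^ truncated_exponent (\<pi> q) n else 1)"

lemma test_modulus_pos: "0 < test_modulus \<pi> b n"
  unfolding test_modulus_def by (intro prod_pos) (auto simp: prime_gt_0_nat)

lemma test_modulus_alt: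
  "test_modulus \<pi> b n = (\<Prod>q\<in>{q. prime q \<and> q < b}. q ^ truncated_exponent (\<pi> q) n)"
  unfolding test_modulus_def by (subst prod.inter_filter[symmetric]) (auto intro!: prod.cong)

lemma test_modulus_dvd: "supernatural_dvd (supernatural_of_nat (test_modulus \<pi> b n)) \<pi>"
  unfolding supernatural_dvd_def supernatural_of_nat_def
proof (intro allI impI)
  fix p :: nat assume p: "prime p"
  have fin: "finite {q. prime q \<and> q < b}"
    by simp
  have "multiplicity p (test_modulus \<pi> b n) = (if p < b then truncated_exponent (\<pi> p) n else 0)"
    unfolding test_modulus_alt using multiplicity_prod_prime_powers[OF fin _ p] p by auto
  then show "enat (multiplicity p (test_modulus \<pi> b n)) \<le> \<pi> p"
    using enat_truncated_exponent[of "\<pi> p" n] by (auto simp: zero_enat_def[symmetric])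
qed

text \<open>
  A prime below \<open>b\<close> with a large exponent, or a prime above all those that occur in the terms,
  forces the relevant integer to vanish because of its size.
\<close>

lemma cong_coefficient_if_cong_test_modulus:
  assumes s: "s \<in> sigma_terms \<pi> A" and t: "t \<in> sigma_terms \<pi> A"
    and n: "n = 2 ^ Suc (term_code c s + term_code c t)"
    and b: "(\<forall>q. prime q \<and> \<pi> q \<noteq> 0 \<longrightarrow> q < b) \<or> (\<exists>q. prime q \<and> \<pi> q \<noteq> 0 \<and> n < q \<and> q < b)"
    and cong: "[coefficient (test_modulus \<pi> b n) a s = coefficient (test_modulus \<pi> b n) a t]
      (mod test_modulus \<pi> b n)"
    and m: "supernatural_dvd (supernatural_of_nat m) \<pi>" "0 < m"
  shows "[coefficient m a s = coefficient m a t] (mod m)"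
proof -
  define X where "X = (\<lambda>q. numer q a s * denom q t - numer q a t * denom q s)"
  have X_le: "\<bar>X q\<bar> \<le> int n" for q
    using cross_difference_bound[OF s t, of q a c] by (simp add: X_def n)
  have small: "X q = 0" if "int k dvd X q" "n < k" for q k
    using that X_le[of q] zdvd_not_zless[of "\<bar>X q\<bar>" "int k"] by fastforce
  have tested: "int (q ^ truncated_exponent (\<pi> q) n) dvd X q" if q: "prime q" "q < b" for q
  proof -
    define e where "e = truncated_exponent (\<pi> q) n"
    have dvd: "q ^ e dvd test_modulus \<pi> b n"
      unfolding test_modulus_alt e_def using q
      by (intro dvd_prodI[where f = "\<lambda>q. q ^ truncated_exponent (\<pi> q) n"]) auto
    then have le: "q ^ e \<le> test_modulus \<pi> b n"
      using test_modulus_pos by (intro dvd_imp_le)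
    have "0 < q ^ e"
      using q by (simp add: prime_gt_0_nat)
    \<comment> \<open>The hypothesis at the test modulus passes to its divisor \<open>q ^ e\<close>;
      afterwards both coefficients are lowered to stage \<open>q ^ e\<close>.\<close>
    then have "[coefficient (q ^ e) a s = coefficient (q ^ e) a t] (mod q ^ e)"
      using cong_coefficient[OF _ le, of a s] cong_coefficient[OF _ le, of a t] cong_dvd_modulus_nat[OF cong dvd]
      by (meson cong_sym cong_trans)
    then show ?thesis
      using prime_power_dvd_coefficient_diff_iff[OF s t q(1)] by (simp add: X_def e_def)
  qed
  have X_dvd: "int (q ^ e) dvd X q" if q: "prime q" and e: "enat e \<le> \<pi> q" for q e
  proof (cases "q < b")
    case True
    show ?thesis
    proof (cases "e \<le> n")
      case True
      then have "enat e \<le> enat (truncated_exponent (\<pi> q) n)"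
        using e by (simp add: enat_truncated_exponent)
      then have "q ^ e dvd q ^ truncated_exponent (\<pi> q) n"
        by (intro le_imp_power_dvd) simp
      then show ?thesis
        using tested[OF q \<open>q < b\<close>] dvd_trans of_nat_dvd_iff by blast
    next
      case False
      \<comment> \<open>Now \<open>\<pi> q\<close> is at least \<open>n\<close>, so divisibility by
        \<open>q ^ n\<close> was tested. This power exceeds \<open>n\<close>, the bound on the
        absolute value of \<open>X q\<close>, and forces \<open>X q\<close> to vanish.\<close>
      then have "enat n \<le> \<pi> q"
        using e by (meson enat_ord_simps(1) nle_le order_trans)
      then have "truncated_exponent (\<pi> q) n = n"
        using enat_truncated_exponent[of "\<pi> q" n] by (simp add: min_absorb2)
      moreover have "n < q ^ n"
        using q prime_gt_1_nat by (intro power_gt_expt) simp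
      ultimately have "X q = 0"
        using small tested[OF q \<open>q < b\<close>] by metis
      then show ?thesis
        by simp
    qed
  next
    case False
    show ?thesis
    proof (cases "\<pi> q = 0")
      case True
      then show ?thesis
        using e by (simp add: zero_enat_def)
    next
      case nz: False
      \<comment> \<open>\<open>q\<close> is in the support but not below \<open>b\<close>, which
        excludes the first alternative of assumption \<open>b\<close>; the second provides a tested
        prime beyond \<open>n\<close>.\<close>
      then obtain r where r: "prime r" "\<pi> r \<noteq> 0" "n < r" "r < b"
        using b False q by blast
      have "1 \<le> truncated_exponent (\<pi> r) n"
      proof -
        have "enat 1 \<le> min (\<pi> r) (enat n)"
          using r(2) by (cases "\<pi> r") (auto simp: n zero_enat_def Suc_le_eq)
        then show ?thesis
          by (simp flip: enat_truncated_exponent)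
      qed
      then have "r dvd r ^ truncated_exponent (\<pi> r) n"
        by (intro dvd_power) simp
      then have "int r dvd X r"
        using tested[OF r(1,4)] dvd_trans of_nat_dvd_iff by blast
      then have "X r = 0"
        using r(3) by (rule small)
      \<comment> \<open>Both primes exceed \<open>n\<close> and hence both codes, because
        \<open>n < r < b \<le> q\<close>; so the fractions at \<open>q\<close> and \<open>r\<close>
        coincide.\<close>
      moreover have "X q = X r"
      proof -
        have "term_code c s + term_code c t < n"
          unfolding n by (metis Suc_lessD less_exp)
        then have "term_code c s < q" "term_code c s < r" "term_code c t < q" "term_code c t < r"
          using r False by linarith+
        then show ?thesis
          using fraction_at_large_prime[of c s q r] fraction_at_large_prime[of c t q r]
          by (simp add: X_def)
      qed
      ultimately show ?thesis
        by simp
    qed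
  qed
  \<comment> \<open>The exponent of \<open>q\<close> in \<open>m\<close> is at most
    \<open>\<pi> q\<close>, so \<open>X_dvd\<close> gives a congruence at stage
    \<open>q ^ e\<close>, which is then lifted to stage \<open>m\<close>.\<close>
  have cong_pp: "int (q ^ e) dvd int (coefficient m a s) - int (coefficient m a t)"
    if q: "prime q" and e: "e = multiplicity q m" for q e
  proof -
    have dvd: "q ^ e dvd m"
      unfolding e by (rule multiplicity_dvd)
    then have le: "q ^ e \<le> m"
      using m(2) by (rule dvd_imp_le)
    have "enat e \<le> \<pi> q"
      using m(1) q e by (simp add: supernatural_dvd_def supernatural_of_nat_def)
    then have "[coefficient (q ^ e) a s = coefficient (q ^ e) a t] (mod q ^ e)"
      using X_dvd[OF q] prime_power_dvd_coefficient_diff_iff[OF s t q] by (simp add: X_def)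
    then have "[coefficient m a s = coefficient m a t] (mod q ^ e)"
      using cong_coefficient[OF _ le, of a s] cong_coefficient[OF _ le, of a t] q
      by (metis cong_sym cong_trans prime_gt_0_nat zero_less_power)
    then show ?thesis
      by (simp only: cong_iff_dvd_diff flip: cong_int_iff)
  qed
  define d where "d = int (coefficient m a s) - int (coefficient m a t)"
  \<comment> \<open>Divisibility by \<open>m\<close> is assembled from prime powers by comparing
    multiplicities, which is informative only for a nonzero difference.\<close>
  have "m dvd nat \<bar>d\<bar>"
  proof (cases "d = 0")
    case False
    show ?thesis
    proof (rule multiplicity_le_imp_dvd)
      fix q :: nat assume q: "prime q"
      have "q ^ multiplicity q m dvd nat \<bar>d\<bar>"
        using cong_pp[OF q refl] by (simp add: d_def)
      then show "multiplicity q m \<le> multiplicity q (nat \<bar>d\<bar>)"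
        using q False by (subst (asm) power_dvd_iff_le_multiplicity) (auto simp: prime_gt_1_nat)
    qed (use m in auto)
  qed simp
  then show ?thesis
    by (simp add: d_def cong_iff_dvd_diff flip: cong_int_iff)
qed

section \<open>Values of terms in the free profinite group\<close>

lemma group_exponent:
  assumes "group G" "finite (carrier G)"
  shows "0 < group_exponent G" "x \<in> carrier G \<Longrightarrow> x [^]\<^bsub>G\<^esub> group_exponent G = \<one>\<^bsub>G\<^esub>"
proof -
  \<comment> \<open>The order of the group witnesses that the minimum in the definition of the
    exponent exists.\<close>
  have "0 < order G \<and> (\<forall>x\<in>carrier G. x [^]\<^bsub>G\<^esub> order G = \<one>\<^bsub>G\<^esub>)"
    using assms group.pow_order_eq_1 monoid.order_gt_0_iff_finite[OF group.is_monoid] by metis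
  then have "0 < group_exponent G \<and> (\<forall>x\<in>carrier G. x [^]\<^bsub>G\<^esub> group_exponent G = \<one>\<^bsub>G\<^esub>)"
    unfolding group_exponent_def by (rule LeastI)
  then show "0 < group_exponent G" "x \<in> carrier G \<Longrightarrow> x [^]\<^bsub>G\<^esub> group_exponent G = \<one>\<^bsub>G\<^esub>"
    by auto
qed

text \<open>Division with remainder: \<open>n mod e\<close> annihilates the group too, and a
  positive remainder would contradict the minimality of the exponent \<open>e\<close>.\<close>

lemma group_exponent_dvd:
  assumes "group G" "finite (carrier G)" "\<And>x. x \<in> carrier G \<Longrightarrow> x [^]\<^bsub>G\<^esub> n = \<one>\<^bsub>G\<^esub>"
  shows "group_exponent G dvd n"
proof (rule ccontr)
  interpret group G by fact
  define e where "e = group_exponent G"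
  assume "\<not> group_exponent G dvd n"
  then have "0 < n mod e"
    by (simp add: e_def mod_greater_zero_iff_not_dvd)
  moreover have "x [^]\<^bsub>G\<^esub> (n mod e) = \<one>\<^bsub>G\<^esub>" if x: "x \<in> carrier G" for x
  proof -
    have "\<one>\<^bsub>G\<^esub> = x [^]\<^bsub>G\<^esub> (e * (n div e) + n mod e)"
      using assms(3)[OF x] by simp
    also have "\<dots> = (x [^]\<^bsub>G\<^esub> e) [^]\<^bsub>G\<^esub> (n div e) \<otimes>\<^bsub>G\<^esub> x [^]\<^bsub>G\<^esub> (n mod e)"
      using x by (simp only: nat_pow_mult nat_pow_pow nat_pow_closed)
    also have "x [^]\<^bsub>G\<^esub> e = \<one>\<^bsub>G\<^esub>"
      unfolding e_def using group_exponent(2)[OF assms(1,2) x] .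
    finally show ?thesis
      using x by simp
  qed
  ultimately have "e \<le> n mod e"
    unfolding e_def group_exponent_def by (intro Least_le) auto
  moreover have "n mod e < e"
    using group_exponent(1)[OF assms(1,2)] by (simp add: e_def)
  ultimately show False
    by simp
qed

lemma free_Abelian_coset_eq_iff:
  assumes N: "subgroup N (free_Abelian_group A)"
    and x: "Poly_Mapping.keys x \<subseteq> A" and y: "Poly_Mapping.keys y \<subseteq> A"
  shows "N #>\<^bsub>free_Abelian_group A\<^esub> x = N #>\<^bsub>free_Abelian_group A\<^esub> y \<longleftrightarrow> x - y \<in> N"
proof -
  interpret F: group "free_Abelian_group A"
    by simp
  have "N #>\<^bsub>free_Abelian_group A\<^esub> x = N #>\<^bsub>free_Abelian_group A\<^esub> y
      \<longleftrightarrow> x \<in> N #>\<^bsub>free_Abelian_group A\<^esub> y"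
    using F.repr_independence[OF _ _ N, of x y] F.rcos_self[OF _ N, of x] x y by auto
  also have "\<dots> \<longleftrightarrow> x - y \<in> N"
    using subgroup.rcos_module[OF N F.group_axioms, of y x] x y by simp
  finally show ?thesis .
qed

lemma Ab_kernelsD:
  assumes "N \<in> Ab_kernels \<pi> A"
  shows "N \<lhd> free_Abelian_group A" "subgroup N (free_Abelian_group A)"
    and "group (free_Abelian_group A Mod N)"
    and "0 < group_exponent (free_Abelian_group A Mod N)"
    and "supernatural_dvd (supernatural_of_nat (group_exponent (free_Abelian_group A Mod N))) \<pi>"
    and "Poly_Mapping.keys z \<subseteq> A \<Longrightarrow>
      frag_cmul (int (group_exponent (free_Abelian_group A Mod N))) z \<in> N"
proof -
  let ?F = "free_Abelian_group A"
  let ?e = "group_exponent (?F Mod N)"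
  show N: "N \<lhd> ?F"
    using assms by (simp add: Ab_kernels_def)
  then show sub: "subgroup N ?F"
    by (rule normal_imp_subgroup)
  show grp: "group (?F Mod N)"
    using N by (rule normal.factorgroup_is_group)
  have fin: "finite (carrier (?F Mod N))" and dvd: "supernatural_dvd (supernatural_of_nat ?e) \<pi>"
    using assms by (auto simp: Ab_kernels_def in_Ab_def)
  show "0 < ?e" "supernatural_dvd (supernatural_of_nat ?e) \<pi>"
    using group_exponent(1)[OF grp fin] dvd by auto
  assume z: "Poly_Mapping.keys z \<subseteq> A"
  have "N = (N #>\<^bsub>?F\<^esub> z) [^]\<^bsub>?F Mod N\<^esub> ?e"
    using group_exponent(2)[OF grp fin, of "N #>\<^bsub>?F\<^esub> z"] z by (simp add: carrier_FactGroup)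
  also have "\<dots> = N #>\<^bsub>?F\<^esub> frag_cmul (int ?e) z"
    using z by (simp add: normal.FactGroup_pow[OF N])
  finally show "frag_cmul (int ?e) z \<in> N"
    using group.coset_join1[of ?F N "frag_cmul (int ?e) z"] sub z keys_cmul[of "int ?e" z] by auto
qed

text \<open>Dividing all coefficients by the exponent \<open>e\<close> writes \<open>x\<close> as an
  \<open>e\<close>-fold multiple, and such multiples die in the quotient.\<close>

lemma frag_divisible_in_kernel:
  assumes "N \<in> Ab_kernels \<pi> A" "Poly_Mapping.keys x \<subseteq> A"
    and "\<And>a. a \<in> A \<Longrightarrow> int (group_exponent (free_Abelian_group A Mod N)) dvd Poly_Mapping.lookup x a"
  shows "x \<in> N"
proof -
  let ?e = "int (group_exponent (free_Abelian_group A Mod N))"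
  define z where "z = Poly_Mapping.map (\<lambda>k. k div ?e) x"
  have z: "Poly_Mapping.lookup z a = Poly_Mapping.lookup x a div ?e" for a
    by (simp add: z_def Poly_Mapping.map.rep_eq when_def)
  have "x = frag_cmul ?e z"
  proof (rule poly_mapping_eqI)
    fix a
    show "Poly_Mapping.lookup x a = Poly_Mapping.lookup (frag_cmul ?e z) a"
    proof (cases "a \<in> A")
      case True
      then show ?thesis
        using assms(3) by (simp add: z)
    next
      case False
      then have "Poly_Mapping.lookup x a = 0"
        using assms(2) by (auto simp: in_keys_iff)
      then show ?thesis
        by (simp add: z)
    qed
  qed
  moreover have "Poly_Mapping.keys z \<subseteq> A"
    using assms(2) by (force simp: in_keys_iff z)
  ultimately show ?thesis
    using Ab_kernelsD(6)[OF assms(1)] by metis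
qed

primrec term_frag :: "nat \<Rightarrow> 'a sigma_term \<Rightarrow> ('a \<Rightarrow>\<^sub>0 int)" where
  "term_frag K (Var a) = frag_of a"
| "term_frag K (Mult s t) = term_frag K s + term_frag K t"
| "term_frag K (Omega t) = frag_cmul (int (fact K - 1)) (term_frag K t)"
| "term_frag K (Prime_Omega p t) = frag_cmul (int (p ^ (fact K - 1))) (term_frag K t)"

lemma lookup_term_frag: "Poly_Mapping.lookup (term_frag K t) a = int (coefficient K a t)"
  by (induction t) (auto simp: lookup_add)

lemma keys_term_frag: "t \<in> sigma_terms \<pi> A \<Longrightarrow> Poly_Mapping.keys (term_frag K t) \<subseteq> A"
proof (induction rule: sigma_terms.induct)
  case (2 s t)
  then show ?case
    using keys_add[of "term_frag K s" "term_frag K t"] by auto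
qed auto

text \<open>Two terms and two stages are allowed because there are two uses: changing the stage for
  one term, and comparing two terms at one stage.\<close>

lemma term_frag_coset_eqI:
  assumes "N \<in> Ab_kernels \<pi> A" "s \<in> sigma_terms \<pi> A" "t \<in> sigma_terms \<pi> A"
    and "\<And>a. a \<in> A \<Longrightarrow>
      [coefficient K a s = coefficient L a t] (mod group_exponent (free_Abelian_group A Mod N))"
  shows "N #>\<^bsub>free_Abelian_group A\<^esub> term_frag K s = N #>\<^bsub>free_Abelian_group A\<^esub> term_frag L t"
proof -
  have "term_frag K s - term_frag L t \<in> N"
  proof (rule frag_divisible_in_kernel[OF assms(1)])
    show "Poly_Mapping.keys (term_frag K s - term_frag L t) \<subseteq> A"
      using keys_diff[of "term_frag K s" "term_frag L t"] keys_term_frag[OF assms(2), of K]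
        keys_term_frag[OF assms(3), of L] by blast
    fix a assume "a \<in> A"
    then show "int (group_exponent (free_Abelian_group A Mod N))
        dvd Poly_Mapping.lookup (term_frag K s - term_frag L t) a"
      using assms(4)[of a] by (simp add: lookup_minus lookup_term_frag cong_iff_dvd_diff flip: cong_int_iff)
  qed
  then show ?thesis
    using free_Abelian_coset_eq_iff[OF Ab_kernelsD(2)[OF assms(1)]
        keys_term_frag[OF assms(2)] keys_term_frag[OF assms(3)]] by blast
qed

text \<open>The stage is the exponent of the quotient, from which on the coefficients are stable; by
  \<open>term_coset_eq\<close> any larger stage gives the same coset.\<close>

definition term_coset :: "'a set \<Rightarrow> 'a sigma_term \<Rightarrow> ('a \<Rightarrow>\<^sub>0 int) set \<Rightarrow> ('a \<Rightarrow>\<^sub>0 int) set" where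
  "term_coset A t N = N #>\<^bsub>free_Abelian_group A\<^esub>
     term_frag (group_exponent (free_Abelian_group A Mod N)) t"

lemma term_coset_eq:
  assumes "N \<in> Ab_kernels \<pi> A" "t \<in> sigma_terms \<pi> A"
    and "group_exponent (free_Abelian_group A Mod N) \<le> K"
  shows "term_coset A t N = N #>\<^bsub>free_Abelian_group A\<^esub> term_frag K t"
  unfolding term_coset_def
  by (intro term_frag_coset_eqI[OF assms(1,2,2)] cong_sym[OF cong_coefficient]
      Ab_kernelsD(4)[OF assms(1)] assms(3))

lemma term_coset_pow:
  assumes "N \<in> Ab_kernels \<pi> A" "t \<in> sigma_terms \<pi> A"
    and "group_exponent (free_Abelian_group A Mod N) \<le> K"
  shows "term_coset A t N [^]\<^bsub>free_Abelian_group A Mod N\<^esub> (n::nat)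
    = N #>\<^bsub>free_Abelian_group A\<^esub> frag_cmul (int n) (term_frag K t)"
  using keys_term_frag[OF assms(2), of K]
  by (simp add: term_coset_eq[OF assms] normal.FactGroup_pow[OF Ab_kernelsD(1)[OF assms(1)]])

section \<open>Powers and limits in the inverse limit\<close>

lemma carrier_free_pro_Ab:
  "x \<in> carrier (free_pro_Ab \<pi> A) \<longleftrightarrow>
    x \<in> (\<Pi>\<^sub>E N\<in>Ab_kernels \<pi> A. carrier (free_Abelian_group A Mod N)) \<and>
    (\<forall>M\<in>Ab_kernels \<pi> A. \<forall>N\<in>Ab_kernels \<pi> A. N \<subseteq> M \<longrightarrow> x N \<subseteq> x M)"
  by (simp add: free_pro_Ab_def Let_def)

lemma mult_free_pro_Ab:
  "x \<otimes>\<^bsub>free_pro_Ab \<pi> A\<^esub> y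
    = (\<lambda>N\<in>Ab_kernels \<pi> A. x N \<otimes>\<^bsub>free_Abelian_group A Mod N\<^esub> y N)"
  by (simp add: free_pro_Ab_def Let_def)

lemma one_free_pro_Ab:
  "\<one>\<^bsub>free_pro_Ab \<pi> A\<^esub> = (\<lambda>N\<in>Ab_kernels \<pi> A. \<one>\<^bsub>free_Abelian_group A Mod N\<^esub>)"
  by (simp add: free_pro_Ab_def Let_def)

lemma pow_free_pro_Ab:
  "x [^]\<^bsub>free_pro_Ab \<pi> A\<^esub> (n::nat) = (\<lambda>N\<in>Ab_kernels \<pi> A. x N [^]\<^bsub>free_Abelian_group A Mod N\<^esub> n)"
proof (induction n)
  case 0
  show ?case
    unfolding nat_pow_0 by (rule one_free_pro_Ab)
next
  case (Suc n)
  show ?case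
    unfolding nat_pow_Suc Suc mult_free_pro_Ab by (rule restrict_ext) simp
qed

text \<open>Cosets are multiplied as sets, and set products are monotone, so the inclusions between
  components survive taking powers.\<close>

lemma pow_in_free_pro_Ab:
  assumes "x \<in> carrier (free_pro_Ab \<pi> A)"
  shows "x [^]\<^bsub>free_pro_Ab \<pi> A\<^esub> (n::nat) \<in> carrier (free_pro_Ab \<pi> A)"
proof -
  have x: "x N \<in> carrier (free_Abelian_group A Mod N)" if "N \<in> Ab_kernels \<pi> A" for N
    using assms that by (auto simp: carrier_free_pro_Ab)
  have "x N [^]\<^bsub>free_Abelian_group A Mod N\<^esub> n \<subseteq> x M [^]\<^bsub>free_Abelian_group A Mod M\<^esub> n"
    if "M \<in> Ab_kernels \<pi> A" "N \<in> Ab_kernels \<pi> A" "N \<subseteq> M" for M N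
  proof (induction n)
    case (Suc n)
    moreover have "x N \<subseteq> x M"
      using assms that by (simp add: carrier_free_pro_Ab)
    ultimately show ?case
      by (simp add: mono_set_mult)
  qed (use that in simp)
  moreover have "x N [^]\<^bsub>free_Abelian_group A Mod N\<^esub> n \<in> carrier (free_Abelian_group A Mod N)"
    if "N \<in> Ab_kernels \<pi> A" for N
    using monoid.nat_pow_closed[OF group.is_monoid[OF Ab_kernelsD(3)[OF that]] x[OF that]] .
  ultimately show ?thesis
    unfolding pow_free_pro_Ab by (auto simp: carrier_free_pro_Ab)
qed

text \<open>Convergence in a product of discrete spaces means that each component is eventually
  constant. The Hausdorff property makes the limit unique, as the definite description in
  \<open>limit_power\<close> demands.\<close>

lemma limit_power_eq:
  assumes x: "x \<in> carrier (free_pro_Ab \<pi> A)" and y: "y \<in> carrier (free_pro_Ab \<pi> A)"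
    and lim: "\<And>N. N \<in> Ab_kernels \<pi> A \<Longrightarrow>
      \<forall>\<^sub>F k in sequentially. x N [^]\<^bsub>free_Abelian_group A Mod N\<^esub> e k = y N"
  shows "limit_power \<pi> A e x = y"
proof -
  let ?T = "free_pro_Ab_topology \<pi> A"
  let ?f = "\<lambda>k. x [^]\<^bsub>free_pro_Ab \<pi> A\<^esub> e k"
  have "limitin ?T ?f y sequentially"
    unfolding free_pro_Ab_topology_def limitin_subtopology limitin_componentwise
  proof (intro conjI ballI always_eventually allI)
    fix k
    show "?f k \<in> carrier (free_pro_Ab \<pi> A)"
      using x by (rule pow_in_free_pro_Ab)
    then show "?f k \<in> topspace (product_topology
        (\<lambda>N. discrete_topology (carrier (free_Abelian_group A Mod N))) (Ab_kernels \<pi> A))"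
      by (simp add: carrier_free_pro_Ab)
  next
    fix N assume N: "N \<in> Ab_kernels \<pi> A"
    show "limitin (discrete_topology (carrier (free_Abelian_group A Mod N)))
        (\<lambda>k. ?f k N) (y N) sequentially"
    proof (rule limitin_eventually)
      show "y N \<in> topspace (discrete_topology (carrier (free_Abelian_group A Mod N)))"
        using y N by (auto simp: carrier_free_pro_Ab)
      show "\<forall>\<^sub>F k in sequentially. ?f k N = y N"
        using lim[OF N] N by (simp add: pow_free_pro_Ab)
    qed
  qed (use y in \<open>auto simp: carrier_free_pro_Ab PiE_iff\<close>)
  moreover have "Hausdorff_space ?T"
    unfolding free_pro_Ab_topology_def
    by (intro Hausdorff_space_subtopology)
      (simp add: Hausdorff_space_product_topology Hausdorff_space_discrete_topology)
  ultimately show ?thesis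
    unfolding limit_power_def
    by (intro the_equality) (auto intro: limitin_Hausdorff_unique[of ?T ?f _ sequentially])
qed

lemma term_coset_in_free_pro_Ab:
  assumes t: "t \<in> sigma_terms \<pi> A"
  shows "(\<lambda>N\<in>Ab_kernels \<pi> A. term_coset A t N) \<in> carrier (free_pro_Ab \<pi> A)"
proof -
  have "term_coset A t N \<subseteq> term_coset A t M"
    if "M \<in> Ab_kernels \<pi> A" "N \<in> Ab_kernels \<pi> A" "N \<subseteq> M" for M N
  proof -
    \<comment> \<open>The two components are defined at different stages; at the common stage
      \<open>K\<close> they are cosets of one and the same element.\<close>
    define K where "K = max (group_exponent (free_Abelian_group A Mod M))
      (group_exponent (free_Abelian_group A Mod N))"
    have "term_coset A t N = N #>\<^bsub>free_Abelian_group A\<^esub> term_frag K t"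
      "term_coset A t M = M #>\<^bsub>free_Abelian_group A\<^esub> term_frag K t"
      by (rule term_coset_eq; use t that in \<open>simp add: K_def\<close>)+
    then show ?thesis
      using \<open>N \<subseteq> M\<close> by (auto simp: r_coset_def)
  qed
  then show ?thesis
    using keys_term_frag[OF t]
    by (auto simp: carrier_free_pro_Ab carrier_FactGroup term_coset_def)
qed

text \<open>Covers \<open>Omega\<close> and \<open>Prime_Omega\<close> at once. In the quotient by
  \<open>N\<close> the sequence of powers is constant as soon as \<open>k\<close> reaches the
  exponent.\<close>

lemma limit_power_term_coset:
  assumes s: "s \<in> sigma_terms \<pi> A" and t: "t \<in> sigma_terms \<pi> A"
    and e: "\<And>k. term_frag k s = frag_cmul (int (e k)) (term_frag k t)"
  shows "limit_power \<pi> A e (\<lambda>N\<in>Ab_kernels \<pi> A. term_coset A t N)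
    = (\<lambda>N\<in>Ab_kernels \<pi> A. term_coset A s N)"
proof (rule limit_power_eq)
  fix N assume N: "N \<in> Ab_kernels \<pi> A"
  have "term_coset A t N [^]\<^bsub>free_Abelian_group A Mod N\<^esub> e k = term_coset A s N"
    if "group_exponent (free_Abelian_group A Mod N) \<le> k" for k
    using term_coset_pow[OF N t that] term_coset_eq[OF N s that] by (simp add: e)
  then show "\<forall>\<^sub>F k in sequentially. (\<lambda>N\<in>Ab_kernels \<pi> A. term_coset A t N) N
      [^]\<^bsub>free_Abelian_group A Mod N\<^esub> e k = (\<lambda>N\<in>Ab_kernels \<pi> A. term_coset A s N) N"
    using N eventually_sequentially by auto
qed (use s t term_coset_in_free_pro_Ab in auto)

lemma sigma_value_eq:
  assumes "t \<in> sigma_terms \<pi> A"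
  shows "sigma_value \<pi> A t = (\<lambda>N\<in>Ab_kernels \<pi> A. term_coset A t N)"
  using assms
proof induction
  case (1 a)
  show ?case
    by (simp add: free_pro_Ab_gen_def term_coset_def)
next
  case (2 s t)
  have "term_coset A s N \<otimes>\<^bsub>free_Abelian_group A Mod N\<^esub> term_coset A t N
      = term_coset A (Mult s t) N" if "N \<in> Ab_kernels \<pi> A" for N
    using normal.rcos_sum[OF Ab_kernelsD(1)[OF that]] keys_term_frag[OF 2(1)] keys_term_frag[OF 2(2)]
    by (simp add: term_coset_def)
  then show ?case
    using 2 by (simp add: mult_free_pro_Ab cong: restrict_cong)
next
  case (3 t)
  then have "Omega t \<in> sigma_terms \<pi> A"
    by (intro sigma_terms.intros)
  then show ?case
    unfolding sigma_value.simps omega_minus_one_def 3(2)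
    by (rule limit_power_term_coset[OF _ 3(1) term_frag.simps(3)])
next
  case (4 p t)
  then have "Prime_Omega p t \<in> sigma_terms \<pi> A"
    by (intro sigma_terms.intros)
  then show ?case
    unfolding sigma_value.simps prime_omega_minus_one_def 4(3)
    by (rule limit_power_term_coset[OF _ 4(2) term_frag.simps(4)])
qed

section \<open>Reduction of all coefficients modulo \<open>m\<close>\<close>

definition multiples :: "'a set \<Rightarrow> nat \<Rightarrow> ('a \<Rightarrow>\<^sub>0 int) set" where
  "multiples A m = {x. Poly_Mapping.keys x \<subseteq> A \<and> (\<forall>a. int m dvd Poly_Mapping.lookup x a)}"

lemma subgroup_multiples: "subgroup (multiples A m) (free_Abelian_group A)"
proof (rule group.subgroupI)
  show "multiples A m \<noteq> {}"
    unfolding multiples_def by (rule ex_in_conv[THEN iffD1], rule exI[of _ 0]) simp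
next
  fix x y assume xy: "x \<in> multiples A m" "y \<in> multiples A m"
  then show "x \<otimes>\<^bsub>free_Abelian_group A\<^esub> y \<in> multiples A m"
    using keys_add[of x y] by (auto simp: multiples_def lookup_add)
  show "inv\<^bsub>free_Abelian_group A\<^esub> x \<in> multiples A m"
    using xy by (auto simp: multiples_def)
qed (auto simp: multiples_def)

text \<open>These quotients detect coefficients modulo \<open>m\<close>. The bound on the exponent
  allows their components to be read at stage \<open>m\<close>; it is only an inequality, since for
  empty \<open>A\<close> the exponent is 1.\<close>

lemma multiples_Ab_kernel:
  assumes A: "finite A" and m: "0 < m" and dvd: "supernatural_dvd (supernatural_of_nat m) \<pi>"
  shows "multiples A m \<in> Ab_kernels \<pi> A" "group_exponent (free_Abelian_group A Mod multiples A m) \<le> m"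
proof -
  let ?F = "free_Abelian_group A"
  let ?N = "multiples A m"
  have sub: "subgroup ?N ?F"
    by (rule subgroup_multiples)
  have normal: "?N \<lhd> ?F"
    using comm_group.subgroup_imp_normal[OF abelian_free_Abelian_group sub] .
  have comm: "comm_group (?F Mod ?N)"
    using comm_group.abelian_FactGroup[OF abelian_free_Abelian_group sub] .
  then have grp: "group (?F Mod ?N)"
    by (rule comm_group.axioms(2))
  \<comment> \<open>Representatives with coefficients reduced modulo \<open>m\<close>: finitely many
    because \<open>A\<close> is finite, and one in every coset.\<close>
  define R where "R = {x. Poly_Mapping.keys x \<subseteq> A \<and> (\<forall>a. Poly_Mapping.lookup x a \<in> {0..<int m})}"
  have "finite (Poly_Mapping.lookup ` R)"
  proof (rule finite_subset)
    show "Poly_Mapping.lookup ` R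
        \<subseteq> {f. \<forall>a. (a \<in> A \<longrightarrow> f a \<in> {0..<int m}) \<and> (a \<notin> A \<longrightarrow> f a = 0)}"
      by (auto simp: R_def in_keys_iff subset_iff)
    show "finite {f. \<forall>a. (a \<in> A \<longrightarrow> f a \<in> {0..<int m}) \<and> (a \<notin> A \<longrightarrow> f a = 0)}"
      using A by (intro finite_set_of_finite_funs) auto
  qed
  then have "finite R"
    by (rule finite_imageD) (simp add: inj_on_def poly_mapping_eqI)
  moreover have "carrier (?F Mod ?N) \<subseteq> (\<lambda>x. ?N #>\<^bsub>?F\<^esub> x) ` R"
  proof
    fix X assume "X \<in> carrier (?F Mod ?N)"
    then obtain x where x: "Poly_Mapping.keys x \<subseteq> A" "X = ?N #>\<^bsub>?F\<^esub> x"
      by (auto simp: carrier_FactGroup)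
    define r where "r = Poly_Mapping.map (\<lambda>k. k mod int m) x"
    have r: "Poly_Mapping.lookup r a = Poly_Mapping.lookup x a mod int m" for a
      by (simp add: r_def Poly_Mapping.map.rep_eq when_def)
    have keys: "Poly_Mapping.keys r \<subseteq> A"
      using x(1) by (force simp: in_keys_iff r)
    then have "r \<in> R"
      using m by (simp add: R_def r)
    moreover have "x - r \<in> ?N"
      using keys_diff[of x r] keys x(1) by (auto simp: multiples_def lookup_minus r)
    then have "X = ?N #>\<^bsub>?F\<^esub> r"
      using free_Abelian_coset_eq_iff[OF sub x(1) keys] x(2) by simp
    ultimately show "X \<in> (\<lambda>x. ?N #>\<^bsub>?F\<^esub> x) ` R"
      by blast
  qed
  ultimately have fin: "finite (carrier (?F Mod ?N))"
    using finite_surj by blast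
  have "group_exponent (?F Mod ?N) dvd m"
  proof (rule group_exponent_dvd[OF grp fin])
    fix X assume "X \<in> carrier (?F Mod ?N)"
    then obtain x where x: "Poly_Mapping.keys x \<subseteq> A" "X = ?N #>\<^bsub>?F\<^esub> x"
      by (auto simp: carrier_FactGroup)
    have "frag_cmul (int m) x \<in> ?N"
      using x(1) by (auto simp: multiples_def)
    then have "?N #>\<^bsub>?F\<^esub> frag_cmul (int m) x = ?N"
      using group.coset_join2[OF _ _ sub] subgroup.mem_carrier[OF sub] by simp
    then show "X [^]\<^bsub>?F Mod ?N\<^esub> m = \<one>\<^bsub>?F Mod ?N\<^esub>"
      using x by (simp add: normal.FactGroup_pow[OF normal])
  qed
  then show "group_exponent (?F Mod ?N) \<le> m"
    using m by (rule dvd_imp_le)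
  have "supernatural_dvd (supernatural_of_nat (group_exponent (?F Mod ?N))) \<pi>"
    unfolding supernatural_dvd_def supernatural_of_nat_def
  proof (intro allI impI)
    fix p :: nat assume "prime p"
    have "multiplicity p (group_exponent (?F Mod ?N)) \<le> multiplicity p m"
      using \<open>group_exponent (?F Mod ?N) dvd m\<close> m by (intro dvd_imp_multiplicity_le) auto
    also have "enat (multiplicity p m) \<le> \<pi> p"
      using dvd \<open>prime p\<close> by (simp add: supernatural_dvd_def supernatural_of_nat_def)
    finally show "enat (multiplicity p (group_exponent (?F Mod ?N))) \<le> \<pi> p"
      by simp
  qed
  then show "?N \<in> Ab_kernels \<pi> A"
    using normal comm fin by (simp add: Ab_kernels_def in_Ab_def)
qed

text \<open>From left to right, compare the components at \<open>multiples A m\<close>; conversely,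
  the component at \<open>N\<close> is settled by taking for \<open>m\<close> the exponent of the
  quotient by \<open>N\<close>.\<close>

lemma sigma_value_eq_iff:
  assumes A: "finite A" and s: "s \<in> sigma_terms \<pi> A" and t: "t \<in> sigma_terms \<pi> A"
  shows "sigma_value \<pi> A s = sigma_value \<pi> A t \<longleftrightarrow>
    (\<forall>m>0. supernatural_dvd (supernatural_of_nat m) \<pi> \<longrightarrow>
      (\<forall>a\<in>A. [coefficient m a s = coefficient m a t] (mod m)))"
proof (intro iffI allI impI ballI)
  fix m a assume eq: "sigma_value \<pi> A s = sigma_value \<pi> A t"
    and m: "0 < m" "supernatural_dvd (supernatural_of_nat m) \<pi>" and "a \<in> A"
  note N = multiples_Ab_kernel[OF A m]
  have "term_coset A s (multiples A m) = term_coset A t (multiples A m)"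
    using fun_cong[OF eq, of "multiples A m"] N(1) by (simp add: sigma_value_eq s t)
  then have "term_frag m s - term_frag m t \<in> multiples A m"
    using free_Abelian_coset_eq_iff[OF subgroup_multiples keys_term_frag[OF s] keys_term_frag[OF t]]
    by (simp add: term_coset_eq[OF N(1) s N(2)] term_coset_eq[OF N(1) t N(2)])
  then show "[coefficient m a s = coefficient m a t] (mod m)"
    by (simp add: multiples_def lookup_minus lookup_term_frag cong_iff_dvd_diff flip: cong_int_iff)
next
  assume *: "\<forall>m>0. supernatural_dvd (supernatural_of_nat m) \<pi> \<longrightarrow>
    (\<forall>a\<in>A. [coefficient m a s = coefficient m a t] (mod m))"
  show "sigma_value \<pi> A s = sigma_value \<pi> A t"
    unfolding sigma_value_eq[OF s] sigma_value_eq[OF t]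
  proof (rule restrict_ext)
    fix N assume N: "N \<in> Ab_kernels \<pi> A"
    show "term_coset A s N = term_coset A t N"
      unfolding term_coset_def using * Ab_kernelsD(4,5)[OF N]
      by (intro term_frag_coset_eqI[OF N s t]) blast
  qed
qed

section \<open>Computability of the coefficients\<close>

text \<open>
  A table is a stack of values, the topmost entry of a table of height \<open>x\<close> being the value at
  \<open>x - 1\<close>; it turns the recursion over terms into primitive recursion over their codes.
\<close>

definition table_entry :: "nat \<Rightarrow> nat \<Rightarrow> nat \<Rightarrow> nat" where
  "table_entry x T i =
    fst (prod_decode (rec_nat T (\<lambda>_ r. snd (prod_decode r)) (x - Suc i)))"

text \<open>The recursion of \<open>coefficient\<close> carried out on codes, with recursive calls
  replaced by lookups in the table \<open>T\<close> of height \<open>x\<close>. It is total: tags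
  above 2 are treated like \<open>Prime_Omega\<close>.\<close>

definition code_step :: "nat \<Rightarrow> nat \<Rightarrow> nat \<Rightarrow> nat \<Rightarrow> nat" where
  "code_step l K x T =
    (if fst (prod_decode x) = 0 then
       if snd (prod_decode x) = l then 1 else 0
     else if fst (prod_decode x) = 1 then
       table_entry x T (fst (prod_decode (snd (prod_decode x)))) +
       table_entry x T (snd (prod_decode (snd (prod_decode x))))
     else if fst (prod_decode x) = 2 then
       (fact K - 1) * table_entry x T (snd (prod_decode x))
     else
       fst (prod_decode (snd (prod_decode x))) ^ (fact K - 1) *
       table_entry x T (snd (prod_decode (snd (prod_decode x)))))"

definition code_table :: "nat \<Rightarrow> nat \<Rightarrow> nat \<Rightarrow> nat" where
  "code_table l K x = rec_nat 0 (\<lambda>i r. prod_encode (code_step l K i r, r)) x"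

definition code_coefficient :: "nat \<Rightarrow> nat \<Rightarrow> nat \<Rightarrow> nat" where
  "code_coefficient l K x = code_step l K x (code_table l K x)"

lemma table_entry_code_table:
  "i < x \<Longrightarrow> table_entry x (code_table l K x) i = code_coefficient l K i"
proof (induction x)
  case (Suc x)
  \<comment> \<open>Primitive recursion applies the last pop outermost, whereas a newly pushed entry
    has to be removed first.\<close>
  have pop: "rec_nat T (\<lambda>_ r. snd (prod_decode r)) (Suc n)
      = rec_nat (snd (prod_decode T)) (\<lambda>_ r. snd (prod_decode r)) n" for T n
    by (induction n) auto
  have table: "code_table l K (Suc x) = prod_encode (code_coefficient l K x, code_table l K x)"
    by (simp add: code_table_def code_coefficient_def)
  show ?case
  proof (cases "i = x")
    case True
    then show ?thesis
      by (simp add: table_entry_def table)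
  next
    case False
    then have "i < x" and diff: "Suc x - Suc i = Suc (x - Suc i)"
      using Suc.prems by auto
    have "table_entry (Suc x) (code_table l K (Suc x)) i = table_entry x (code_table l K x) i"
      unfolding table_entry_def diff pop table by simp
    with \<open>i < x\<close> Suc.IH show ?thesis
      by simp
  qed
qed simp

text \<open>Subterms have smaller codes, so their values are already in the table; injectivity of
  \<open>c\<close> makes comparing letters the same as comparing their numbers.\<close>

lemma code_coefficient_term_code:
  assumes "inj_on c A" "t \<in> sigma_terms \<pi> A" "a \<in> A"
  shows "code_coefficient (c a) K (term_code c t) = coefficient K a t"
  using assms(2)
proof induction
  case (1 b)
  then show ?case
    using assms(1,3) by (auto simp: code_coefficient_def code_step_def inj_on_eq_iff)
next
  case (2 s t)
  then have "table_entry (term_code c (Mult s t)) (code_table (c a) K (term_code c (Mult s t)))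
      (term_code c r) = coefficient K a r" if "r = s \<or> r = t" for r
    using that term_code_Mult[of c s t] by (subst table_entry_code_table) auto
  from this[of s] this[of t] show ?case
    by (simp add: code_coefficient_def code_step_def)
next
  case (3 t)
  then have "table_entry (term_code c (Omega t)) (code_table (c a) K (term_code c (Omega t)))
      (term_code c t) = coefficient K a t"
    using term_code_Omega[of c t] by (subst table_entry_code_table) auto
  then show ?case
    by (simp add: code_coefficient_def code_step_def)
next
  case (4 p t)
  then have "table_entry (term_code c (Prime_Omega p t))
      (code_table (c a) K (term_code c (Prime_Omega p t))) (term_code c t) = coefficient K a t"
    using term_code_Prime_Omega[of p c t] by (subst table_entry_code_table) auto
  then show ?case
    by (simp add: code_coefficient_def code_step_def)
qed

lemma computable_table_entry [computable_intros]:
  assumes "computable k f" "computable k g" "computable k h"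
  shows "computable k (\<lambda>xs. table_entry (f xs) (g xs) (h xs))"
  unfolding table_entry_def
  by (intro computable_rec_nat computable_intros assms; simp)

lemma computable_code_step [computable_intros]:
  assumes "computable k f" "computable k g" "computable k h"
  shows "computable k (\<lambda>xs. code_step l (f xs) (g xs) (h xs))"
  unfolding code_step_def by (intro computable_intros assms)

lemma computable_code_coefficient [computable_intros]:
  assumes "computable k f" "computable k g"
  shows "computable k (\<lambda>xs. code_coefficient l (f xs) (g xs))"
proof -
  have "computable 2 (\<lambda>xs. code_coefficient l (xs ! 0) (xs ! 1))"
    unfolding code_coefficient_def code_table_def
    by (intro computable_rec_nat computable_intros; simp)
  then show ?thesis
    by (rule computable_comp2[of "code_coefficient l", OF _ assms])
qed

section \<open>The decision procedure\<close>

lemma recursive_supernatural_computable: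
  assumes "recursive_supernatural \<pi>"
  obtains v where "computable 1 (\<lambda>xs. v (xs ! 0))" "\<And>p. prime p \<Longrightarrow> v p = enat_code (\<pi> p)"
proof -
  obtain f where f: "general_recursive 1 f" "\<And>p. prime p \<Longrightarrow> f [p] = enat_code (\<pi> p)"
    using assms by (auto simp: recursive_supernatural_def)
  have "computable 1 (\<lambda>xs. f [xs ! 0])"
  proof (rule computable_cong[OF general_recursive_imp_computable[OF f(1)]])
    fix xs :: "nat list" assume "length xs = 1"
    then have "xs = [xs ! 0]"
      by (cases xs) auto
    then show "f xs = f [xs ! 0]"
      by metis
  qed
  then show thesis
    using that[of "\<lambda>p. f [p]"] f(2) by blast
qed

lemma computable_test_modulus:
  assumes "recursive_supernatural \<pi>" "computable k f" "computable k g"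
  shows "computable k (\<lambda>xs. test_modulus \<pi> (f xs) (g xs))"
proof -
  obtain v where v: "computable 1 (\<lambda>xs. v (xs ! 0))" "\<And>p. prime p \<Longrightarrow> v p = enat_code (\<pi> p)"
    using assms(1) by (rule recursive_supernatural_computable) blast
  \<comment> \<open>\<open>enat_code\<close> represents infinity by 0 and \<open>k\<close> by
    \<open>Suc k\<close>, hence the case distinction and the predecessor.\<close>
  have truncated_exponent: "truncated_exponent (\<pi> p) n = (if v p = 0 then n else min (v p - 1) n)"
    if "prime p" for p n
    using v(2)[OF that] by (cases "\<pi> p") (auto simp: truncated_exponent_def enat_code_def)
  have "test_modulus \<pi> b n = rec_nat 1 (\<lambda>q r. r *
      (if prime q then q ^ (if v q = 0 then n else min (v q - 1) n) else 1)) b" for b n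
    by (induction b) (auto simp: test_modulus_def truncated_exponent lessThan_Suc)
  moreover have "computable 2 (\<lambda>xs. rec_nat 1 (\<lambda>q r. r *
      (if prime q then q ^ (if v q = 0 then xs ! 1 else min (v q - 1) (xs ! 1)) else 1)) (xs ! 0))"
    by (intro computable_rec_nat computable_intros computable_comp1[OF v(1)]; simp)
  ultimately have "computable 2 (\<lambda>xs. test_modulus \<pi> (xs ! 0) (xs ! 1))"
    by (simp only:)
  then show ?thesis
    by (rule computable_comp2[of "test_modulus \<pi>", OF _ assms(2,3)])
qed

text \<open>
  The only non-uniform step: whether the support of \<open>\<pi>\<close> is finite cannot be decided from \<open>\<pi>\<close>.
\<close>

lemma computable_support_bound:
  assumes "recursive_supernatural \<pi>"
  obtains B where "computable 1 (\<lambda>xs. B (xs ! 0))"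
    and "\<And>n. (\<forall>q. prime q \<and> \<pi> q \<noteq> 0 \<longrightarrow> q < B n) \<or> (\<exists>q. prime q \<and> \<pi> q \<noteq> 0 \<and> n < q \<and> q < B n)"
proof (cases "finite {q. prime q \<and> \<pi> q \<noteq> 0}")
  case True
  then obtain b where "\<forall>q. prime q \<and> \<pi> q \<noteq> 0 \<longrightarrow> q < b"
    by (auto simp: finite_nat_set_iff_bounded)
  then show thesis
    by (intro that[of "\<lambda>_. b"] computable_intros) auto
next
  case False
  obtain v where v: "computable 1 (\<lambda>xs. v (xs ! 0))" "\<And>p. prime p \<Longrightarrow> v p = enat_code (\<pi> p)"
    using assms by (rule recursive_supernatural_computable) blast
  \<comment> \<open>Under \<open>enat_code\<close> the exponent 0 has code 1.\<close>
  have nonzero: "v p \<noteq> 1 \<longleftrightarrow> \<pi> p \<noteq> 0" if "prime p" for p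
    using v(2)[OF that] by (cases "\<pi> p") (auto simp: enat_code_def zero_enat_def)
  have ex: "\<exists>q. n < q \<and> prime q \<and> v q \<noteq> 1" for n
  proof -
    obtain q where "n < q" "prime q" "\<pi> q \<noteq> 0"
      using False by (auto simp: infinite_nat_iff_unbounded)
    then show ?thesis
      using nonzero by blast
  qed
  \<comment> \<open>The least prime of the support beyond \<open>n\<close>; the search is total
    because the support is infinite.\<close>
  define L where "L = (\<lambda>n. LEAST q. n < q \<and> prime q \<and> v q \<noteq> 1)"
  have "computable 1 (\<lambda>xs. Suc (L (xs ! 0)))"
    unfolding L_def
  proof (intro computable_Suc computable_Least_decidable)
    show "decidable (Suc 1)
        (\<lambda>xs. drop 1 xs ! 0 < xs ! 0 \<and> prime (xs ! 0) \<and> v (xs ! 0) \<noteq> 1)"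
      by (intro computable_intros computable_comp1[OF v(1)]) simp_all
  qed (rule ex)
  moreover have "n < L n \<and> prime (L n) \<and> v (L n) \<noteq> 1" for n
    unfolding L_def using ex by (rule LeastI_ex)
  then have "\<exists>q. prime q \<and> \<pi> q \<noteq> 0 \<and> n < q \<and> q < Suc (L n)" for n
    using nonzero by blast
  ultimately show thesis
    using that[of "\<lambda>n. Suc (L n)"] by blast
qed

theorem corollary3p7:
  fixes \<pi> :: supernatural and A :: "'a set"
  assumes "recursive_supernatural \<pi>" and "finite A"
  shows "decidable_word_problem \<pi> A"
  unfolding decidable_word_problem_def
proof (intro allI impI)
  fix c :: "'a \<Rightarrow> nat" assume c: "inj_on c A"
  obtain B where B: "computable 1 (\<lambda>xs. B (xs ! 0))"
    "\<And>n. (\<forall>q. prime q \<and> \<pi> q \<noteq> 0 \<longrightarrow> q < B n) \<or> (\<exists>q. prime q \<and> \<pi> q \<noteq> 0 \<and> n < q \<and> q < B n)"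
    using assms(1) by (rule computable_support_bound) blast
  \<comment> \<open>The threshold \<open>2 ^ Suc (x + y)\<close> is the bound of
    \<open>cross_difference_bound\<close>, computed from the codes; it serves both as largest
    exponent and as the size that a prime must exceed.\<close>
  define M where "M = (\<lambda>x y. test_modulus \<pi> (B (2 ^ Suc (x + y))) (2 ^ Suc (x + y)))"
  \<comment> \<open>The finitely many letters are built into the procedure as constants, so the
    quantifier is a finite conjunction.\<close>
  define P where "P = (\<lambda>x y. \<forall>a\<in>A. code_coefficient (c a) (M x y) x mod M x y
    = code_coefficient (c a) (M x y) y mod M x y)"
  have "decidable 2 (\<lambda>xs. P (xs ! 0) (xs ! 1))"
    unfolding P_def M_def using assms
    by (intro computable_intros computable_test_modulus computable_comp1[OF B(1)]) simp_all
  then obtain f where f: "general_recursive 2 f"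
      "\<And>xs. length xs = 2 \<Longrightarrow> f xs = of_bool (P (xs ! 0) (xs ! 1))"
    by (auto simp: decidable_def computable_def)
  have "P (term_code c s) (term_code c t) \<longleftrightarrow> sigma_value \<pi> A s = sigma_value \<pi> A t"
    if s: "s \<in> sigma_terms \<pi> A" and t: "t \<in> sigma_terms \<pi> A" for s t
  proof -
    define m where "m = M (term_code c s) (term_code c t)"
    have P: "P (term_code c s) (term_code c t)
        \<longleftrightarrow> (\<forall>a\<in>A. [coefficient m a s = coefficient m a t] (mod m))"
      using code_coefficient_term_code[OF c] s t by (simp add: P_def m_def cong_def)
    show ?thesis
      unfolding P sigma_value_eq_iff[OF assms(2) s t]
    proof (intro iffI allI impI ballI)
      fix n a
      assume *: "\<forall>a\<in>A. [coefficient m a s = coefficient m a t] (mod m)"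
        and n: "0 < n" "supernatural_dvd (supernatural_of_nat n) \<pi>" and "a \<in> A"
      then have "[coefficient m a s = coefficient m a t] (mod m)"
        by blast
      then show "[coefficient n a s = coefficient n a t] (mod n)"
        unfolding m_def M_def
        by (rule cong_coefficient_if_cong_test_modulus[OF s t refl B(2) _ n(2,1)])
    next
      fix a
      assume *: "\<forall>n>0. supernatural_dvd (supernatural_of_nat n) \<pi> \<longrightarrow>
        (\<forall>a\<in>A. [coefficient n a s = coefficient n a t] (mod n))" and "a \<in> A"
      \<comment> \<open>The test modulus divides \<open>\<pi>\<close>, so it is itself one of the
        moduli covered by the assumption.\<close>
      moreover have "0 < m" "supernatural_dvd (supernatural_of_nat m) \<pi>"
        by (simp_all add: m_def M_def test_modulus_pos test_modulus_dvd)
      ultimately show "[coefficient m a s = coefficient m a t] (mod m)"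
        by simp
    qed
  qed
  then show "\<exists>f. general_recursive 2 f \<and> (\<forall>s\<in>sigma_terms \<pi> A. \<forall>t\<in>sigma_terms \<pi> A.
      f [term_code c s, term_code c t] = (if sigma_value \<pi> A s = sigma_value \<pi> A t then 1 else 0))"
    using f by (intro exI[of _ f]) auto
qed

end
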